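(* Let $\mathbb{K}$ be an algebraically closed field of characteristic zero and let $A$ be a subalgebra of $\mathbb{K}[x]$ of codimension two. Then the type $T(A)$ is either $(2,5)$ or $(3,4,5)$. The spectrum of $A$ contains $s\le 4$ elements, and depending on $s$ we have the following possibilities, where $\alpha,\beta,\gamma,\delta$ denote different elements of the spectrum and $a,b\in\mathbb{K}$: - ($s=1$) $A=\{f\mid f'(\alpha)=0,\ af''(\alpha)+bf'''(\alpha)=0\}$. If $a=0$, $b\neq0$ then $T(A)=(2,5)$, and if $a\neq0$ then $T(A)=(3,4,5)$. - ($s=2$) $A=\{f\mid f(\alpha)=f(\beta),\ af'(\alpha)+bf'(\beta)=0\}$. If $a=b\neq0$ then $T(A)=(2,5)$, and if $a\neq b$ then $T(A)=(3,4,5)$. - ($s=2$) $A=\{f\mid f'(\alpha)=f'(\beta)=0\}$. In this case $T(A)$ is always $(3,4,5)$. - ($s=3$) $A=\{f\mid f(\alpha)=f(\beta),\ f'(\gamma)=0\}$. If $\alpha+\beta=2\gamma$ then $T(A)=(2,5)$, and if $\alpha+\beta\neq2\gamma$ then $T(A)=(3,4,5)$. - ($s=3$) $A=\{f\mid f(\alpha)=f(\beta)=f(\gamma)\}$. In this case $T(A)$ is always $(3,4,5)$. - ($s=4$) $A=\{f\mid f(\alpha)=f(\beta),\ f(\gamma)=f(\delta)\}$. If $\alpha+\beta=\gamma+\delta$ then $T(A)=(2,5)$, and if $\alpha+\beta\neq\gamma+\delta$ then $T(A)=(3,4,5)$.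
   Context: Subalgebras of $\mathbb{K}[x]$ contain all constants; codimension of $A$ is $\dim_{\mathbb{K}}\mathbb{K}[x]/A$; sets $\{f\mid\dots\}$ range over $f\in\mathbb{K}[x]$. The spectrum $Sp(A)$ of a subalgebra $A$ of finite codimension is the set of $\alpha\in\mathbb{K}$ such that either $f'(\alpha)=0$ for all $f\in A$, or there exists $\beta\neq\alpha$ in $\mathbb{K}$ with $f(\alpha)=f(\beta)$ for all $f\in A$. The type $T(A)=(d_1,\dots,d_r)$ is the ordered list of minimal generators of the semigroup $\{\deg f\mid f\in A \text{ non-constant}\}$ (equivalently the degrees of the elements of a minimal SAGBI basis of $A$). *)

theory Defs
  imports "HOL-Computational_Algebra.Polynomial"
begin

definition subalgebra :: "'a::field poly set \<Rightarrow> bool" where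
  "subalgebra A \<longleftrightarrow>
     (\<forall>c. [:c:] \<in> A) \<and> (\<forall>f\<in>A. \<forall>g\<in>A. f + g \<in> A) \<and> (\<forall>f\<in>A. \<forall>g\<in>A. f * g \<in> A)"

text \<open>
  The dimension of \<open>K[x]/A\<close> is \<open>n\<close> iff there are polynomials \<open>q 0, \<dots>, q (n - 1)\<close> whose cosets
  form a basis of \<open>K[x]/A\<close>. The two conjuncts say that these cosets span and are linearly
  independent; equality of cosets modulo \<open>A\<close> is written out as membership of the difference
  in \<open>A\<close>.
\<close>

definition has_codim :: "'a::field poly set \<Rightarrow> nat \<Rightarrow> bool" where
  "has_codim A n \<longleftrightarrow> (\<exists>q :: nat \<Rightarrow> 'a poly.
     (\<forall>f. \<exists>c. f - (\<Sum>i<n. smult (c i) (q i)) \<in> A) \<and>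
     (\<forall>c. (\<Sum>i<n. smult (c i) (q i)) \<in> A \<longrightarrow> (\<forall>i<n. c i = 0)))"

definition spectrum :: "'a::field poly set \<Rightarrow> 'a set" where
  "spectrum A = {\<alpha>. (\<forall>f\<in>A. poly (pderiv f) \<alpha> = 0) \<or>
                     (\<exists>\<beta>. \<beta> \<noteq> \<alpha> \<and> (\<forall>f\<in>A. poly f \<alpha> = poly f \<beta>))}"

definition degree_semigroup :: "'a::field poly set \<Rightarrow> nat set" where
  "degree_semigroup A = {degree f | f. f \<in> A \<and> degree f > 0}"

inductive_set semigroup_gen :: "nat set \<Rightarrow> nat set" for G :: "nat set" where
  base: "g \<in> G \<Longrightarrow> g \<in> semigroup_gen G"
| add: "m \<in> semigroup_gen G \<Longrightarrow> n \<in> semigroup_gen G \<Longrightarrow> m + n \<in> semigroup_gen G"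

definition minimal_generating_set :: "nat set \<Rightarrow> nat set \<Rightarrow> bool" where
  "minimal_generating_set S G \<longleftrightarrow>
     semigroup_gen G = S \<and> (\<forall>H. H \<subset> G \<longrightarrow> semigroup_gen H \<noteq> S)"

text \<open>
  The definite description below denotes by lemma \<open>ex1_minimal_generating_set\<close>, since the degree
  semigroup of a subalgebra is an additively closed set of positive integers.
\<close>

definition type_of :: "'a::field poly set \<Rightarrow> nat list" where
  "type_of A = sorted_list_of_set (THE G. minimal_generating_set (degree_semigroup A) G)"

lemma degree_semigroup_pos: "0 \<notin> degree_semigroup A"
  by (auto simp: degree_semigroup_def)

lemma degree_semigroup_add:
  assumes "subalgebra A" "m \<in> degree_semigroup A" "n \<in> degree_semigroup A"
  shows "m + n \<in> degree_semigroup A"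
proof -
  obtain f g where fg: "f \<in> A" "degree f = m" "m > 0" "g \<in> A" "degree g = n" "n > 0"
    using assms(2,3) by (auto simp: degree_semigroup_def)
  then have "f \<noteq> 0" "g \<noteq> 0" by auto
  then have "degree (f * g) = m + n" using fg by (simp add: degree_mult_eq)
  moreover have "f * g \<in> A" using assms(1) fg by (auto simp: subalgebra_def)
  ultimately show ?thesis using fg unfolding degree_semigroup_def
    by (smt (verit) add_gr_0 mem_Collect_eq)
qed

lemma semigroup_gen_subset:
  assumes "G \<subseteq> S" "\<And>m n. m \<in> S \<Longrightarrow> n \<in> S \<Longrightarrow> m + n \<in> S"
  shows "semigroup_gen G \<subseteq> S"
proof
  fix x assume "x \<in> semigroup_gen G"
  then show "x \<in> S" by induction (use assms in auto)
qed

lemma minimal_generating_set_iff: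
  assumes pos: "0 \<notin> S" and add: "\<And>m n. m \<in> S \<Longrightarrow> n \<in> S \<Longrightarrow> m + n \<in> S"
  shows "minimal_generating_set S G \<longleftrightarrow> G = {d \<in> S. \<forall>m\<in>S. \<forall>n\<in>S. d \<noteq> m + n}"
proof -
  define I where "I = {d \<in> S. \<forall>m\<in>S. \<forall>n\<in>S. d \<noteq> m + n}"
  have sub: "I \<subseteq> H" if "semigroup_gen H = S" for H
  proof
    fix d assume d: "d \<in> I"
    then have "d \<in> semigroup_gen H" using that by (auto simp: I_def)
    then show "d \<in> H" by cases (use d that in \<open>auto simp: I_def\<close>)
  qed
  have in_gen: "d \<in> S \<Longrightarrow> d \<in> semigroup_gen I" for d
  proof (induction d rule: less_induct)
    case (less d)
    show ?case
    proof (cases "d \<in> I")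
      case True
      then show ?thesis by (rule semigroup_gen.base)
    next
      case False
      then obtain m n where mn: "m \<in> S" "n \<in> S" "d = m + n"
        using less.prems by (auto simp: I_def)
      then have "m > 0" "n > 0" using pos by (metis gr0I)+
      then show ?thesis using mn less.IH by (auto intro: semigroup_gen.add)
    qed
  qed
  have gen: "semigroup_gen I = S"
  proof
    show "semigroup_gen I \<subseteq> S" by (rule semigroup_gen_subset) (use add in \<open>auto simp: I_def\<close>)
    show "S \<subseteq> semigroup_gen I" using in_gen by blast
  qed
  show ?thesis
    unfolding minimal_generating_set_def I_def[symmetric] using sub gen by blast
qed

lemma ex1_minimal_generating_set:
  assumes "subalgebra A"
  shows "\<exists>!G. minimal_generating_set (degree_semigroup A) G"
  using minimal_generating_set_iff[OF degree_semigroup_pos degree_semigroup_add[OF assms]]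
  by simp

end

theory Submission
  imports Defs
begin

text \<open>
  Let \<open>A\<close> have codimension two in \<open>R = K[x]\<close>. Everything follows from one observation: \<open>A\<close> acts on
  the two-dimensional space \<open>R/A\<close> by commuting endomorphisms, and commuting \<open>2 \<times> 2\<close> matrices span,
  together with the identity, a space of dimension at most two. Hence among \<open>1\<close> and any two
  elements \<open>w\<close>, \<open>v\<close> of \<open>A\<close> some nontrivial combination \<open>g\<close> acts as zero, that is, \<open>g R \<subseteq> A\<close>
  (\<open>conductor_combination\<close>).

  The degrees occurring in \<open>A\<close> form a semigroup with exactly two gaps, so they are either
  \<open>2, 4, 5, 6, \<dots>\<close> or \<open>3, 4, 5, \<dots>\<close>. This gives the two types, and it reduces the question of the type
  to whether \<open>A\<close> contains a quadratic polynomial, which is checked directly on each algebra of the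
  list. It also allows \<open>w\<close> to be taken of degree 2 or 3 and \<open>v\<close> of degree 4, which yields a \<open>g\<close> of
  degree 3 or 4. In degree 3, \<open>A = K + g R\<close>. In degree 4, \<open>A = K + K w + g R\<close>, and \<open>w\<close> is a root of a
  quadratic polynomial modulo \<open>g\<close>. Over an algebraically closed field \<open>w\<close> can then be replaced by
  an element \<open>u\<close> that modulo \<open>g\<close> is either nilpotent, \<open>g dvd u * u\<close>, or idempotent,
  \<open>g dvd u * (u - 1)\<close> (\<open>codim_2_normal_form\<close>).

  Write \<open>const_mod h\<close> for \<open>K + h R\<close>, the polynomials that are constant modulo \<open>h\<close>. An idempotent
  splits \<open>g\<close> into two coprime factors \<open>g0\<close>, \<open>g1\<close> with \<open>A = const_mod g0 \<inter> const_mod g1\<close>. In the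
  nilpotent case either \<open>A = const_mod h\<close> for a cubic divisor \<open>h\<close> of \<open>g\<close>, or \<open>g\<close> is the square of a
  quadratic \<open>h\<close> and \<open>u\<close> is a multiple of \<open>h\<close> by a factor prime to \<open>h\<close>. So up to a trivial linear
  factor there are three shapes: one cubic, two coprime quadratics, one squared quadratic. Sorting
  each of them by coincidences among the roots gives the algebras of the list, and translating
  divisibility by a product of linear factors into values and derivatives gives their equations.

  For the spectrum, the equations show that the named points belong to it. Conversely, if
  \<open>g R \<subseteq> A\<close> then \<open>A\<close> separates points and tangent directions away from the roots of \<open>g\<close>
  (\<open>spectrum_subset_roots\<close>).
\<close>

section \<open>The action on the two-dimensional quotient\<close>

lemma subalgebraD:
  assumes "subalgebra A"
  shows subalgebra_const: "[:c:] \<in> A"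
    and subalgebra_add: "f \<in> A \<Longrightarrow> g \<in> A \<Longrightarrow> f + g \<in> A"
    and subalgebra_mult: "f \<in> A \<Longrightarrow> g \<in> A \<Longrightarrow> f * g \<in> A"
  using assms by (auto simp: subalgebra_def)

lemma subalgebra_smult: "subalgebra A \<Longrightarrow> f \<in> A \<Longrightarrow> smult c f \<in> A"
  using subalgebra_mult[of A "[:c:]" f] by (simp add: subalgebra_const)

lemma subalgebra_diff: "subalgebra A \<Longrightarrow> f \<in> A \<Longrightarrow> g \<in> A \<Longrightarrow> f - g \<in> A"
  using subalgebra_add[of A f "smult (-1) g"] subalgebra_smult[of A g "-1"] by simp

lemmas subalgebra_intros =
  subalgebra_const subalgebra_add subalgebra_mult subalgebra_smult subalgebra_diff

lemma has_codim_2_basis: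
  assumes "has_codim A 2"
  obtains q r where "\<And>f. \<exists>c d. f - smult c q - smult d r \<in> A"
    and "\<And>c d. smult c q + smult d r \<in> A \<Longrightarrow> c = 0 \<and> d = 0"
proof -
  obtain q where span: "\<And>f. \<exists>c. f - (\<Sum>i<(2::nat). smult (c i) (q i)) \<in> A"
    and indep: "\<And>c. (\<Sum>i<(2::nat). smult (c i) (q i)) \<in> A \<Longrightarrow> \<forall>i<2. c i = 0"
    using assms unfolding has_codim_def by blast
  have all_less_two: "(\<forall>i<2. P i) \<longleftrightarrow> P 0 \<and> P 1" for P :: "nat \<Rightarrow> bool"
    by (auto simp: less_2_cases_iff)
  have two: "(\<Sum>i<(2::nat). smult (c i) (q i)) = smult (c 0) (q 0) + smult (c 1) (q 1)" for c
    by (simp add: numeral_2_eq_2)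
  show ?thesis
  proof (rule that)
    show "\<exists>c d. f - smult c (q 0) - smult d (q 1) \<in> A" for f
      using span[of f] unfolding two by (metis diff_diff_eq)
    show "c = 0 \<and> d = 0" if "smult c (q 0) + smult d (q 1) \<in> A" for c d
      using indep[of "\<lambda>i. if i = 0 then c else d"] that
      unfolding two by (simp add: all_less_two)
  qed
qed

lemma two_equations_three_unknowns:
  fixes a1 :: "'a::field"
  shows "\<exists>x y z. (x \<noteq> 0 \<or> y \<noteq> 0 \<or> z \<noteq> 0) \<and> a1 * x + b1 * y + c1 * z = 0 \<and> a2 * x + b2 * y + c2 * z = 0"
proof (cases "b1 * c2 - c1 * b2 = 0 \<and> c1 * a2 - a1 * c2 = 0 \<and> a1 * b2 - b1 * a2 = 0")
  case False
  \<comment> \<open>The cross product of the two rows is orthogonal to both.\<close>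
  have "a1 * (b1 * c2 - c1 * b2) + b1 * (c1 * a2 - a1 * c2) + c1 * (a1 * b2 - b1 * a2) = 0"
    "a2 * (b1 * c2 - c1 * b2) + b2 * (c1 * a2 - a1 * c2) + c2 * (a1 * b2 - b1 * a2) = 0"
    by algebra+
  with False show ?thesis by blast
next
  case minors: True
  consider "a1 = 0" "b1 = 0" "c1 = 0" "a2 = 0" | "a1 = 0" "b1 = 0" "c1 = 0" "a2 \<noteq> 0"
    | "a1 \<noteq> 0 \<or> b1 \<noteq> 0" | "c1 \<noteq> 0" "a1 = 0" by blast
  then show ?thesis
  proof cases
    case 1
    then show ?thesis by (intro exI[of _ 1] exI[of _ 0]) auto
  next
    case 2
    then show ?thesis by (intro exI[of _ "-b2"] exI[of _ a2] exI[of _ 0]) auto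
  next
    case 3
    then show ?thesis
      using minors by (intro exI[of _ "b1"] exI[of _ "-a1"] exI[of _ 0]) (auto simp: algebra_simps)
  next
    case 4
    then show ?thesis using minors by (intro exI[of _ 1] exI[of _ 0]) auto
  qed
qed

lemma codim_2_dependent:
  assumes A: "subalgebra A" "has_codim A 2"
  shows "\<exists>x y z. (x \<noteq> 0 \<or> y \<noteq> 0 \<or> z \<noteq> 0) \<and> smult x f + smult y g + smult z h \<in> A"
proof -
  obtain q r where span: "\<And>f. \<exists>c d. f - smult c q - smult d r \<in> A"
    using has_codim_2_basis[OF A(2)] by metis
  obtain c d where cd: "\<And>f. f - smult (c f) q - smult (d f) r \<in> A"
    using span by metis
  obtain x y z where xyz: "x \<noteq> 0 \<or> y \<noteq> 0 \<or> z \<noteq> 0"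
    "c f * x + c g * y + c h * z = 0" "d f * x + d g * y + d h * z = 0"
    using two_equations_three_unknowns by metis
  have "smult x (f - smult (c f) q - smult (d f) r) + smult y (g - smult (c g) q - smult (d g) r)
        + smult z (h - smult (c h) q - smult (d h) r) \<in> A"
    by (intro subalgebra_intros A cd)
  also have "smult x (f - smult (c f) q - smult (d f) r) + smult y (g - smult (c g) q - smult (d g) r)
        + smult z (h - smult (c h) q - smult (d h) r) =
        smult x f + smult y g + smult z h - smult (c f * x + c g * y + c h * z) q
         - smult (d f * x + d g * y + d h * z) r"
    by (simp add: smult_diff_right smult_diff_left smult_add_right smult_add_left algebra_simps)
  finally show ?thesis using xyz by auto
qed

text \<open>
  The lower bound on the dimension of \<open>K[x]/A\<close>, as \<open>codim_2_dependent\<close> is the upper bound.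
\<close>

lemma codim_2_not_spanned_by_one:
  assumes A: "subalgebra A" "has_codim A 2"
  shows "\<exists>f. \<forall>c. f - smult c p \<notin> A"
proof (rule ccontr)
  assume "\<not> ?thesis"
  then obtain s where s: "\<And>f. f - smult (s f) p \<in> A" by metis
  obtain q r where indep: "\<And>c d. smult c q + smult d r \<in> A \<Longrightarrow> c = 0 \<and> d = 0"
    using has_codim_2_basis[OF A(2)] by metis
  have "smult (s r) (q - smult (s q) p) - smult (s q) (r - smult (s r) p) \<in> A"
    by (intro subalgebra_intros A s)
  also have "smult (s r) (q - smult (s q) p) - smult (s q) (r - smult (s r) p)
      = smult (s r) q + smult (- s q) r"
    by (simp add: smult_diff_right algebra_simps)
  finally have "s q = 0" using indep by fastforce
  with s[of q] have "smult 1 q + smult 0 r \<in> A" by simp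
  then show False using indep by fastforce
qed

text \<open>
  The three hypotheses are the entries of the identity \<open>M M' = M' M\<close> for the matrices with rows
  \<open>(p, q)\<close>, \<open>(r, s)\<close> and \<open>(p', q')\<close>, \<open>(r', s')\<close>. They say that the traceless parts, given by the vectors
  \<open>(p - s, q, r)\<close> and \<open>(p' - s', q', r')\<close>, are parallel; the conclusion is that a combination of the two
  matrices is scalar.
\<close>

lemma commuting_2x2_dependent:
  fixes p :: "'a::field"
  assumes "q * r' = q' * r" "(p - s) * q' = (p' - s') * q" "(p - s) * r' = (p' - s') * r"
  shows "\<exists>x y. (x \<noteq> 0 \<or> y \<noteq> 0) \<and> x * (p - s) + y * (p' - s') = 0 \<and> x * q + y * q' = 0 \<and>
    x * r + y * r' = 0"
proof -
  consider "p - s \<noteq> 0" | "q \<noteq> 0" | "r \<noteq> 0" | "p - s = 0" "q = 0" "r = 0" by blast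
  then show ?thesis
  proof cases
    case 1
    then show ?thesis using assms
      by (intro exI[of _ "s' - p'"] exI[of _ "p - s"]) (auto simp: algebra_simps)
  next
    case 2
    then show ?thesis using assms
      by (intro exI[of _ "-q'"] exI[of _ "q"]) (auto simp: algebra_simps)
  next
    case 3
    then show ?thesis using assms
      by (intro exI[of _ "-r'"] exI[of _ "r"]) (auto simp: algebra_simps)
  next
    case 4
    then show ?thesis by (intro exI[of _ 1] exI[of _ 0]) auto
  qed
qed

text \<open>
  The matrices of \<open>a\<close> and \<open>b\<close> on \<open>K[x]/A\<close> commute because \<open>K[x]\<close> is commutative, so some nontrivial
  combination of them is scalar. Subtracting that scalar gives an element of \<open>A\<close> that acts as zero,
  which means that it multiplies all of \<open>K[x]\<close> into \<open>A\<close>.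
\<close>

lemma conductor_combination:
  assumes A: "subalgebra A" "has_codim A 2" and ab: "a \<in> A" "b \<in> A"
  shows "\<exists>z x y. (x \<noteq> 0 \<or> y \<noteq> 0) \<and> (\<forall>f. ([:z:] + smult x a + smult y b) * f \<in> A)"
proof -
  obtain u v where span: "\<And>f. \<exists>c d. f - smult c u - smult d v \<in> A"
    and indep: "\<And>c d. smult c u + smult d v \<in> A \<Longrightarrow> c = 0 \<and> d = 0"
    using has_codim_2_basis[OF A(2)] by metis
  obtain p r where au: "a * u - smult p u - smult r v \<in> A" using span by blast
  obtain q s where av: "a * v - smult q u - smult s v \<in> A" using span by blast
  obtain p' r' where bu: "b * u - smult p' u - smult r' v \<in> A" using span by blast
  obtain q' s' where bv: "b * v - smult q' u - smult s' v \<in> A" using span by blast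
  have "a * (b * u - smult p' u - smult r' v) + smult p' (a * u - smult p u - smult r v)
      + smult r' (a * v - smult q u - smult s v)
      - (b * (a * u - smult p u - smult r v) + smult p (b * u - smult p' u - smult r' v)
      + smult r (b * v - smult q' u - smult s' v)) \<in> A" (is "?t \<in> A")
    by (intro subalgebra_intros A ab au av bu bv)
  also have "?t = smult (r * q' - q * r') u + smult ((p - s) * r' - (p' - s') * r) v"
    by (simp add: smult_diff_right smult_diff_left smult_add_right smult_add_left algebra_simps)
  finally have 1: "q * r' = q' * r" "(p - s) * r' = (p' - s') * r"
    using indep by (force simp: algebra_simps)+
  have "a * (b * v - smult q' u - smult s' v) + smult q' (a * u - smult p u - smult r v)
      + smult s' (a * v - smult q u - smult s v)
      - (b * (a * v - smult q u - smult s v) + smult q (b * u - smult p' u - smult r' v)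
      + smult s (b * v - smult q' u - smult s' v)) \<in> A" (is "?t \<in> A")
    by (intro subalgebra_intros A ab au av bu bv)
  also have "?t = smult ((p' - s') * q - (p - s) * q') u + smult (q * r' - q' * r) v"
    by (simp add: smult_diff_right smult_diff_left smult_add_right smult_add_left algebra_simps)
  finally have 2: "(p - s) * q' = (p' - s') * q"
    using indep by (force simp: algebra_simps)+
  obtain x y where xy: "x \<noteq> 0 \<or> y \<noteq> 0" "x * (p - s) + y * (p' - s') = 0" "x * q + y * q' = 0"
    "x * r + y * r' = 0"
    using commuting_2x2_dependent[OF 1(1) 2 1(2)] by blast
  \<comment> \<open>The combination \<open>x a + y b\<close> acts as the scalar \<open>x p + y p' = x s + y s'\<close>.\<close>
  define z where "z = - (x * p + y * p')"
  have z': "z + x * s + y * s' = 0" using xy(2) unfolding z_def by (simp add: algebra_simps)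
  define g where "g = [:z:] + smult x a + smult y b"
  have g: "g \<in> A" unfolding g_def by (intro subalgebra_intros A ab)
  have "smult x (a * u - smult p u - smult r v) + smult y (b * u - smult p' u - smult r' v)
      = g * u - smult (z + x * p + y * p') u - smult (x * r + y * r') v"
    by (simp add: g_def smult_diff_right smult_diff_left smult_add_right smult_add_left algebra_simps)
  moreover have "smult x (a * u - smult p u - smult r v) + smult y (b * u - smult p' u - smult r' v) \<in> A"
    by (intro subalgebra_intros A au bu)
  ultimately have gu: "g * u \<in> A" using xy by (simp add: z_def)
  have "smult x (a * v - smult q u - smult s v) + smult y (b * v - smult q' u - smult s' v)
      = g * v - smult (x * q + y * q') u - smult (z + x * s + y * s') v"
    by (simp add: g_def smult_diff_right smult_diff_left smult_add_right smult_add_left algebra_simps)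
  moreover have "smult x (a * v - smult q u - smult s v) + smult y (b * v - smult q' u - smult s' v) \<in> A"
    by (intro subalgebra_intros A av bv)
  ultimately have gv: "g * v \<in> A" using xy z' by simp
  have "g * f \<in> A" for f
  proof -
    obtain c d where cd: "f - smult c u - smult d v \<in> A" using span by blast
    have "g * (f - smult c u - smult d v) + smult c (g * u) + smult d (g * v) \<in> A"
      by (intro subalgebra_add subalgebra_smult subalgebra_mult[OF A(1) g cd] A gu gv)
    then show ?thesis by (simp add: algebra_simps)
  qed
  then show ?thesis using xy(1) unfolding g_def by blast
qed

section \<open>Degrees and the type\<close>

lemma degree_semigroupE:
  assumes "d \<in> degree_semigroup A"
  obtains f where "f \<in> A" "degree f = d" "d > 0"
  using assms unfolding degree_semigroup_def by blast

lemma degree_semigroupI: "f \<in> A \<Longrightarrow> degree f > 0 \<Longrightarrow> degree f \<in> degree_semigroup A"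
  unfolding degree_semigroup_def by blast

lemma degree_reduce:
  fixes f g :: "'a::field poly"
  assumes "degree g = degree f" "degree f > 0"
  shows "degree (f - smult (lead_coeff f / lead_coeff g) g) < degree f"
proof -
  have "lead_coeff g \<noteq> 0" using assms by (metis degree_0 leading_coeff_0_iff less_irrefl)
  then have "coeff (f - smult (lead_coeff f / lead_coeff g) g) (degree f) = 0"
    using assms by simp
  moreover have "degree (f - smult (lead_coeff f / lead_coeff g) g) \<le> degree f"
    by (intro degree_diff_le order_trans[OF degree_smult_le]) (use assms in auto)
  ultimately show ?thesis
    by (metis assms(2) degree_0 le_neq_implies_less leading_coeff_0_iff)
qed

text \<open>
  Polynomial division by degrees: as long as the degree of \<open>f\<close> is attained in \<open>A\<close>, the leading term
  can be removed without changing the class of \<open>f\<close> modulo \<open>A\<close>. With at most one gap \<open>e\<close> only multiples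
  of \<open>x ^ e\<close> survive.
\<close>

lemma spanned_by_one_if_one_gap:
  assumes A: "subalgebra A" and S: "\<And>d. d > 0 \<Longrightarrow> d \<noteq> e \<Longrightarrow> d \<in> degree_semigroup A"
  shows "\<exists>c. f - smult c (monom 1 e) \<in> A"
proof (induction "degree f" arbitrary: f rule: less_induct)
  case less
  show ?case
  proof (cases "degree f = 0")
    case True
    then obtain k where "f = [:k:]" by (rule degree_eq_zeroE)
    then have "f - smult 0 (monom 1 e) \<in> A" using A by (simp add: subalgebra_intros)
    then show ?thesis by blast
  next
    case pos: False
    show ?thesis
    proof (cases "degree f = e")
      case True
      have "degree (f - smult (lead_coeff f / lead_coeff (monom 1 e)) (monom 1 e)) < degree f"
        by (rule degree_reduce) (use True pos in \<open>auto simp: degree_monom_eq\<close>)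
      then obtain c where
        "f - smult (lead_coeff f / lead_coeff (monom 1 e)) (monom 1 e) - smult c (monom 1 e) \<in> A"
        using less by blast
      then have "f - smult (lead_coeff f / lead_coeff (monom 1 e) + c) (monom 1 e) \<in> A"
        by (simp add: smult_add_left diff_diff_eq)
      then show ?thesis by blast
    next
      case False
      then obtain g where g: "g \<in> A" "degree g = degree f"
        using S[of "degree f"] pos by (auto elim: degree_semigroupE)
      define k where "k = lead_coeff f / lead_coeff g"
      have "degree (f - smult k g) < degree f"
        unfolding k_def by (rule degree_reduce) (use g pos in auto)
      then obtain c where "f - smult k g - smult c (monom 1 e) \<in> A"
        using less by blast
      then have "f - smult k g - smult c (monom 1 e) + smult k g \<in> A"
        by (intro subalgebra_add subalgebra_smult A g)
      then have "f - smult c (monom 1 e) \<in> A" by (simp add: algebra_simps)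
      then show ?thesis by blast
    qed
  qed
qed

lemma codim_2_second_gap:
  assumes A: "subalgebra A" "has_codim A 2"
  shows "\<exists>d>0. d \<noteq> e \<and> d \<notin> degree_semigroup A"
  using codim_2_not_spanned_by_one[OF A] spanned_by_one_if_one_gap[OF A(1)] by metis

text \<open>
  Three monomials are dependent modulo \<open>A\<close>, so some combination of them lies in \<open>A\<close>, and its degree is
  one of the three exponents.
\<close>

lemma codim_2_no_third_gap:
  assumes A: "subalgebra A" "has_codim A 2" and d: "0 < d1" "d1 < d2" "d2 < d3"
  shows "d1 \<in> degree_semigroup A \<or> d2 \<in> degree_semigroup A \<or> d3 \<in> degree_semigroup A"
proof -
  obtain x y z where xyz: "x \<noteq> 0 \<or> y \<noteq> 0 \<or> z \<noteq> 0"
    and in_A: "smult x (monom 1 d1) + smult y (monom 1 d2) + smult z (monom 1 d3) \<in> A"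
      (is "?f \<in> A")
    using codim_2_dependent[OF A] by blast
  have f: "?f = monom x d1 + monom y d2 + monom z d3" by (simp add: smult_monom)
  have cf: "coeff ?f i = (if i = d1 then x else if i = d2 then y else if i = d3 then z else 0)" for i
    unfolding f using d by (auto simp: coeff_monom)
  have "?f \<noteq> 0"
  proof
    assume "?f = 0"
    then have "coeff ?f i = 0" for i by simp
    then have "x = 0" "y = 0" "z = 0" using cf[of d1] cf[of d2] cf[of d3] d
      by (metis less_irrefl less_trans)+
    then show False using xyz by blast
  qed
  then have "coeff ?f (degree ?f) \<noteq> 0" by (simp only: leading_coeff_0_iff not_False_eq_True)
  then have "degree ?f \<in> {d1, d2, d3}" using cf[of "degree ?f"] by (metis insertCI)
  then show ?thesis using degree_semigroupI[OF in_A] d by auto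
qed

text \<open>
  Degrees add up: if 1 were a degree, there would be no gap, and if 2 and 3 both were, 1 would be the
  only one. So the gaps are 1 and 2, or, when 2 is a degree, 1 and 3.
\<close>

lemma codim_2_degree_semigroup:
  assumes A: "subalgebra A" "has_codim A 2"
  shows "degree_semigroup A = insert 2 {4..} \<or> degree_semigroup A = {3..}"
proof -
  let ?S = "degree_semigroup A"
  note pos = degree_semigroup_pos[of A]
  note add = degree_semigroup_add[OF A(1)]
  have 1: "1 \<notin> ?S"
  proof
    assume one: "1 \<in> ?S"
    have "Suc n \<in> ?S" for n
      using one add[of _ 1] by (induction n) auto
    then have "d \<in> ?S" if "d > 0" for d using that by (metis gr0_implies_Suc)
    then show False using codim_2_second_gap[OF A, of 0] by blast
  qed
  show ?thesis
  proof (cases "2 \<in> ?S")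
    case False
    have "d \<in> ?S" if "d \<ge> 3" for d
      using codim_2_no_third_gap[OF A, of 1 2 d] 1 False that by auto
    moreover have "d \<ge> 3" if "d \<in> ?S" for d
    proof (rule ccontr)
      assume "\<not> 3 \<le> d"
      then have "d = 0 \<or> d = 1 \<or> d = 2" by auto
      then show False using that pos 1 False by auto
    qed
    ultimately have "?S = {3..}" by auto
    then show ?thesis ..
  next
    case True
    have 3: "3 \<notin> ?S"
    proof
      assume three: "3 \<in> ?S"
      have "n + 2 \<in> ?S" for n
      proof (induction n rule: less_induct)
        case (less n)
        consider "n = 0" | "n = 1" | "n \<ge> 2" by linarith
        then show ?case
        proof cases
          case 3
          then have "(n - 2) + 2 \<in> ?S" by (intro less) auto
          then have "(n - 2) + 2 + 2 \<in> ?S" using True by (rule add)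
          moreover have "(n - 2) + 2 + 2 = n + 2" using 3 by arith
          ultimately show ?thesis by (simp only:)
        next
          case 1
          then show ?thesis using True by (metis add_0)
        next
          case 2
          then have "n + 2 = 3" by simp
          then show ?thesis using three by (simp only:)
        qed
      qed
      then have "(d - 2) + 2 \<in> ?S" for d .
      moreover have "d = (d - 2) + 2" if "d > 0" "d \<noteq> 1" for d :: nat using that by arith
      ultimately have "d \<in> ?S" if "d > 0" "d \<noteq> 1" for d using that by metis
      then show False using codim_2_second_gap[OF A, of 1] by blast
    qed
    have 4: "4 \<in> ?S" using add[OF True True] by simp
    have "d \<in> ?S" if "d \<ge> 4" for d
      using codim_2_no_third_gap[OF A, of 1 3 d] 1 3 4 that by auto
    moreover have "d = 2 \<or> d \<ge> 4" if "d \<in> ?S" for d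
    proof (rule ccontr)
      assume "\<not> ?thesis"
      then have "d = 0 \<or> d = 1 \<or> d = 3" by auto
      then show False using that pos 1 3 by auto
    qed
    ultimately have "?S = insert 2 {4..}" using True by auto
    then show ?thesis ..
  qed
qed

text \<open>
  Since \<open>minimal_generating_set_iff\<close> identifies the generators with the indecomposable elements of the
  semigroup, it remains to find those in \<open>{2, 4, 5, \<dots>}\<close> and in \<open>{3, 4, 5, \<dots>}\<close>.
\<close>

lemma codim_2_type:
  assumes A: "subalgebra A" "has_codim A 2"
  shows "type_of A = (if 2 \<in> degree_semigroup A then [2, 5] else [3, 4, 5])"
proof -
  let ?S = "degree_semigroup A"
  let ?G = "{d \<in> ?S. \<forall>m\<in>?S. \<forall>n\<in>?S. d \<noteq> m + n}"
  have the: "(THE G. minimal_generating_set ?S G) = ?G"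
    using minimal_generating_set_iff[OF degree_semigroup_pos degree_semigroup_add[OF A(1)]]
    by simp
  from codim_2_degree_semigroup[OF A] show ?thesis
  proof
    assume "?S = insert 2 {4..}"
    then have S: "d \<in> ?S \<longleftrightarrow> d = 2 \<or> d \<ge> 4" for d by simp
    then have two: "2 \<in> ?S" by simp
    have "d \<in> ?G \<longleftrightarrow> d \<in> {2, 5}" for d
    proof
      assume d: "d \<in> ?G"
      \<comment> \<open>From 6 on, subtracting 2 stays inside the semigroup.\<close>
      have "\<not> d \<ge> 6"
      proof
        assume "d \<ge> 6"
        then have "d - 2 \<in> ?S" "d = 2 + (d - 2)" using S[of "d - 2"] by auto
        then show False using d two by blast
      qed
      moreover have "d \<noteq> 2 + 2" using d two by blast
      ultimately show "d \<in> {2, 5}" using d S[of d] by auto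
    qed (auto simp: S)
    then have "?G = {2, 5}" by blast
    then show ?thesis unfolding type_of_def the using two by simp
  next
    assume "?S = {3..}"
    then have S: "d \<in> ?S \<longleftrightarrow> d \<ge> 3" for d by simp
    then have two: "2 \<notin> ?S" by simp
    have "d \<in> ?G \<longleftrightarrow> d \<in> {3, 4, 5}" for d
    proof
      assume d: "d \<in> ?G"
      have "\<not> d \<ge> 6"
      proof
        assume "d \<ge> 6"
        then have "3 \<in> ?S" "d - 3 \<in> ?S" "d = 3 + (d - 3)" using S[of "d - 3"] S[of 3] by auto
        then show False using d by blast
      qed
      then show "d \<in> {3, 4, 5}" using d S[of d] by auto
    qed (auto simp: S)
    then have "?G = {3, 4, 5}" by blast
    then show ?thesis unfolding type_of_def the using two by simp
  qed
qed

lemma two_in_degree_semigroup_iff: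
  assumes A: "subalgebra A"
  shows "2 \<in> degree_semigroup A \<longleftrightarrow> (\<exists>b. [:0, b, 1:] \<in> A)"
proof
  assume "2 \<in> degree_semigroup A"
  then obtain f where f: "f \<in> A" "degree f = 2" by (auto elim: degree_semigroupE)
  obtain c b a where fe: "f = [:c, b, a:]"
  proof (rule that)
    show "f = [:coeff f 0, coeff f 1, coeff f 2:]"
      using f(2) by (intro poly_eqI)
        (auto simp: coeff_pCons coeff_eq_0 numeral_2_eq_2 split: nat.splits)
  qed
  have "a \<noteq> 0" using f(2) fe by (auto split: if_splits)
  moreover have "smult (1 / a) (f - [:c:]) \<in> A" by (intro subalgebra_intros A f)
  ultimately have "[:0, b / a, 1:] \<in> A" by (simp add: fe)
  then show "\<exists>b. [:0, b, 1:] \<in> A" ..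
next
  assume "\<exists>b. [:0, b, 1:] \<in> A"
  then obtain b where "[:0, b, 1:] \<in> A" ..
  then show "2 \<in> degree_semigroup A" using degree_semigroupI[of "[:0, b, 1:]" A]
    by (simp add: numeral_2_eq_2)
qed

section \<open>Normal forms modulo a polynomial\<close>

definition const_mod :: "'a::field poly \<Rightarrow> 'a poly set" where
  "const_mod g = {f. \<exists>c. g dvd f - [:c:]}"

lemma subalgebra_mod:
  assumes A: "subalgebra A" and g: "\<And>f. g * f \<in> A"
  shows "f mod g \<in> A \<longleftrightarrow> f \<in> A"
proof -
  have "f = g * (f div g) + f mod g" by simp
  moreover have "f mod g = f - g * (f div g)" by (simp add: minus_mult_div_eq_mod)
  ultimately show ?thesis using subalgebra_add[OF A g] subalgebra_diff[OF A _ g] by metis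
qed

text \<open>
  Apply \<open>conductor_combination\<close> to elements \<open>w\<close>, \<open>v\<close> of \<open>A\<close> with the two smallest admissible degrees,
  where \<open>degree w\<close> is 2 or 3 and \<open>degree v = 4\<close>. The resulting \<open>g\<close> has the degree of \<open>v\<close> or of \<open>w\<close>, and
  modulo \<open>g\<close> the algebra is determined by its elements of degree less than \<open>degree g\<close>, of which the
  degree semigroup leaves only \<open>K\<close> or \<open>K + K w\<close>.
\<close>

lemma codim_2_conductor:
  assumes A: "subalgebra A" "has_codim A 2"
  obtains (cubic) g where "degree g = 3" "A = const_mod g"
  | (quartic) g w where "degree g = 4" "w \<in> A" "0 < degree w" "degree w < 4"
      "A = {f. \<exists>c d. g dvd f - [:c:] - smult d w}"
proof -
  obtain e :: nat where e: "e = 2 \<or> e = 3"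
    and S: "\<And>d. d \<in> degree_semigroup A \<longleftrightarrow> d = e \<or> d \<ge> 4"
  proof (cases "degree_semigroup A = insert 2 {4..}")
    case True
    then show ?thesis by (intro that[of 2]) auto
  next
    case False
    then have "degree_semigroup A = {3..}" using codim_2_degree_semigroup[OF A] by simp
    then have "d \<in> degree_semigroup A \<longleftrightarrow> d = 3 \<or> d \<ge> 4" for d
      by (simp only: atLeast_iff) arith
    then show ?thesis by (intro that[of 3]) simp_all
  qed
  have low: "degree f = 0 \<or> degree f = e \<or> degree f \<ge> 4" if "f \<in> A" for f
    using degree_semigroupI[OF that] unfolding S by blast
  obtain w where w: "w \<in> A" "degree w = e" using S[of e] by (auto elim: degree_semigroupE)
  obtain v where v: "v \<in> A" "degree v = 4" using S[of 4] by (auto elim: degree_semigroupE)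
  obtain z x y where xy: "x \<noteq> 0 \<or> y \<noteq> 0" and cond: "\<And>f. ([:z:] + smult x w + smult y v) * f \<in> A"
    using conductor_combination[OF A w(1) v(1)] by blast
  define g where "g = [:z:] + smult x w + smult y v"
  have gA: "g * f \<in> A" for f using cond unfolding g_def .
  note mod_iff = subalgebra_mod[OF A(1) gA]
  show ?thesis
  proof (cases "y = 0")
    case True
    then have "x \<noteq> 0" using xy by simp
    then have "degree g = degree (smult x w + [:z:])" using True by (simp add: g_def add.commute)
    also have "\<dots> = e" using \<open>x \<noteq> 0\<close> w e by (subst degree_add_eq_left) auto
    finally have dg: "degree g = e" .
    \<comment> \<open>For \<open>e = 2\<close> the product \<open>g x\<close> would be an element of degree 3.\<close>
    have e3: "e = 3"
    proof (rule ccontr)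
      assume "e \<noteq> 3"
      then have "e = 2" using e by simp
      then have "degree (g * [:0, 1:]) = 3" using dg by (subst degree_mult_eq) auto
      then show False using low[OF gA[of "[:0, 1:]"]] \<open>e = 2\<close> by auto
    qed
    have g0: "g \<noteq> 0" using dg e3 by auto
    have "A = const_mod g"
    proof (intro set_eqI iffI)
      fix f assume "f \<in> A"
      then have "f mod g \<in> A" by (simp add: mod_iff)
      moreover have "degree (f mod g) < 3" using degree_mod_less[OF g0, of f] dg e3 by auto
      ultimately have "degree (f mod g) = 0" using low e3 by fastforce
      then obtain c where c: "f mod g = [:c:]" by (rule degree_eq_zeroE)
      have "g dvd f - f mod g" by simp
      then show "f \<in> const_mod g" unfolding c const_mod_def by blast
    next
      fix f assume "f \<in> const_mod g"
      then obtain c k where "f - [:c:] = g * k" unfolding const_mod_def dvd_def by blast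
      then have "f = g * k + [:c:]" by (simp add: algebra_simps)
      also have "\<dots> \<in> A" by (intro subalgebra_add subalgebra_const A gA)
      finally show "f \<in> A" .
    qed
    then show ?thesis using cubic dg e3 by simp
  next
    case False
    have "degree g = degree (smult y v + (smult x w + [:z:]))" by (simp add: g_def add.commute)
    also have "\<dots> = 4"
    proof (subst degree_add_eq_left)
      have "degree (smult x w + [:z:]) \<le> 3"
        by (rule degree_add_le) (use w e degree_smult_le[of x w] in auto)
      then show "degree (smult x w + [:z:]) < degree (smult y v)" using False v by simp
      show "degree (smult y v) = 4" using False v by simp
    qed
    finally have dg: "degree g = 4" .
    then have g0: "g \<noteq> 0" by auto
    have "A = {f. \<exists>c d. g dvd f - [:c:] - smult d w}"
    proof (intro set_eqI iffI)
      fix f assume "f \<in> A"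
      then have r: "f mod g \<in> A" by (simp add: mod_iff)
      have "degree (f mod g) < 4" using degree_mod_less[OF g0, of f] dg by auto
      then have "degree (f mod g) = 0 \<or> degree (f mod g) = e" using low[OF r] by auto
      then have "\<exists>d. degree (f mod g - smult d w) = 0"
      proof
        assume "degree (f mod g) = 0"
        then show ?thesis by (intro exI[of _ 0]) simp
      next
        assume de: "degree (f mod g) = e"
        define d where "d = lead_coeff (f mod g) / lead_coeff w"
        have lt: "degree (f mod g - smult d w) < e"
          unfolding d_def using degree_reduce[of w "f mod g"] de w e by auto
        have "f mod g - smult d w \<in> A" by (intro subalgebra_diff subalgebra_smult A r w)
        then have "degree (f mod g - smult d w) = 0" using low lt e by fastforce
        then show ?thesis ..
      qed
      then obtain d c where dc: "f mod g - smult d w = [:c:]" by (metis degree_eq_zeroE)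
      have "g dvd f - f mod g" by simp
      also have "f - f mod g = f - [:c:] - smult d w" unfolding dc[symmetric] by simp
      finally show "f \<in> {f. \<exists>c d. g dvd f - [:c:] - smult d w}" by blast
    next
      fix f assume "f \<in> {f. \<exists>c d. g dvd f - [:c:] - smult d w}"
      then obtain c d k where "f - [:c:] - smult d w = g * k" unfolding dvd_def by blast
      then have "f = g * k + [:c:] + smult d w" by (simp add: algebra_simps)
      also have "\<dots> \<in> A" by (intro subalgebra_add subalgebra_const subalgebra_smult A gA w)
      finally show "f \<in> A" .
    qed
    then show ?thesis using quartic[OF dg w(1)] w e by auto
  qed
qed

text \<open>
  Unique factorization in the form needed below; with roots at hand it follows by distributing the
  linear factors of \<open>g\<close> one at a time.
\<close>

lemma dvd_mult_split:
  fixes g u v :: "'a::alg_closed_field poly"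
  assumes "g dvd u * v" "g \<noteq> 0"
  shows "\<exists>g1 g2. g = g1 * g2 \<and> g1 dvd u \<and> g2 dvd v"
  using assms
proof (induction "degree g" arbitrary: g u v rule: less_induct)
  case less
  show ?case
  proof (cases "degree g = 0")
    case True
    then have "g dvd 1" using less.prems by (simp add: is_unit_iff_degree)
    then have "g dvd u" by (rule dvd_trans) simp
    then show ?thesis by (intro exI[of _ g] exI[of _ 1]) simp
  next
    case False
    then obtain a where "poly g a = 0" using alg_closed_imp_poly_has_root[of g] by blast
    then obtain h where h: "g = [:-a, 1:] * h" by (auto simp: poly_eq_0_iff_dvd dvd_def)
    have h0: "h \<noteq> 0" using h less.prems by auto
    have dh: "degree h < degree g" using h0 by (simp add: h degree_mult_eq del: mult_pCons_left)
    have "[:-a, 1:] dvd u * v" using less.prems h dvd_mult_left by blast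
    then have "poly (u * v) a = 0" by (simp only: poly_eq_0_iff_dvd)
    then consider "poly u a = 0" | "poly v a = 0" by auto
    then show ?thesis
    proof cases
      case 1
      then obtain u' where u': "u = [:-a, 1:] * u'" by (auto simp: poly_eq_0_iff_dvd dvd_def)
      have "[:-a, 1:] * h dvd [:-a, 1:] * (u' * v)" using less.prems h u' by (simp only: mult.assoc)
      then have "h dvd u' * v" by (subst (asm) dvd_mult_cancel_left) simp
      then obtain g1 g2 where "h = g1 * g2" "g1 dvd u'" "g2 dvd v" using less.hyps dh h0 by blast
      then have "g = ([:-a, 1:] * g1) * g2 \<and> [:-a, 1:] * g1 dvd u \<and> g2 dvd v"
        unfolding h u' by (simp only: mult.assoc mult_dvd_mono dvd_refl simp_thms)
      then show ?thesis by blast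
    next
      case 2
      then obtain v' where v': "v = [:-a, 1:] * v'" by (auto simp: poly_eq_0_iff_dvd dvd_def)
      have "[:-a, 1:] * h dvd [:-a, 1:] * (u * v')" using less.prems h v' by (simp only: mult.left_commute)
      then have "h dvd u * v'" by (subst (asm) dvd_mult_cancel_left) simp
      then obtain g1 g2 where "h = g1 * g2" "g1 dvd u" "g2 dvd v'" using less.hyps dh h0 by blast
      then have "g = g1 * ([:-a, 1:] * g2) \<and> g1 dvd u \<and> [:-a, 1:] * g2 dvd v"
        unfolding h v' by (simp only: mult.left_commute mult_dvd_mono dvd_refl simp_thms)
      then show ?thesis by blast
    qed
  qed
qed

lemma quadratic_factors:
  fixes w :: "'a::alg_closed_field poly"
  obtains l m where "w * w - [:c:] - smult d w = (w - [:l:]) * (w - [:m:])"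
proof -
  have "degree [:- c, - d, 1:] > 0" by simp
  then obtain l where l: "poly [:-c, -d, 1:] l = 0"
    using alg_closed_imp_poly_has_root by blast
  then have c: "c = l * l - d * l" by (simp add: algebra_simps)
  have "w * w - [:c:] - smult d w = (w - [:l:]) * (w - [:d - l:])"
    unfolding c by (simp add: algebra_simps smult_diff_left smult_diff_right)
  then show ?thesis by (rule that)
qed

lemma affine_change:
  fixes u w :: "'a::field poly"
  assumes "w = [:l:] + smult k u" "k \<noteq> 0"
  shows "{f. \<exists>c d. g dvd f - [:c:] - smult d w} = {f. \<exists>c d. g dvd f - [:c:] - smult d u}"
proof (intro set_eqI iffI)
  fix f assume "f \<in> {f. \<exists>c d. g dvd f - [:c:] - smult d w}"
  then obtain c d where "g dvd f - [:c:] - smult d w" by blast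
  also have "f - [:c:] - smult d w = f - [:c + d * l:] - smult (d * k) u"
    using assms by (simp add: smult_add_right algebra_simps)
  finally show "f \<in> {f. \<exists>c d. g dvd f - [:c:] - smult d u}" by blast
next
  fix f assume "f \<in> {f. \<exists>c d. g dvd f - [:c:] - smult d u}"
  then obtain c d where "g dvd f - [:c:] - smult d u" by blast
  also have "f - [:c:] - smult d u = f - [:c - d / k * l:] - smult (d / k) w"
    using assms by (simp add: smult_add_right algebra_simps)
  finally show "f \<in> {f. \<exists>c d. g dvd f - [:c:] - smult d w}" by blast
qed

text \<open>
  In the quartic case \<open>w * w\<close> lies in \<open>A = K + K w + (g)\<close>, so \<open>g\<close> divides \<open>(w - l) * (w - m)\<close> for some
  constants \<open>l\<close>, \<open>m\<close>. A translation makes \<open>w\<close> nilpotent modulo \<open>g\<close> if \<open>l = m\<close>; an affine change moves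
  \<open>l\<close>, \<open>m\<close> to 0, 1 otherwise.
\<close>

lemma codim_2_normal_form:
  fixes A :: "'a::alg_closed_field poly set"
  assumes A: "subalgebra A" "has_codim A 2"
  obtains (cubic) g where "degree g = 3" "A = const_mod g"
  | (nilpotent) g u where "degree g = 4" "0 < degree u" "degree u < 4" "g dvd u * u"
      "A = {f. \<exists>c d. g dvd f - [:c:] - smult d u}"
  | (idempotent) g u where "degree g = 4" "0 < degree u" "degree u < 4" "g dvd u * (u - 1)"
      "A = {f. \<exists>c d. g dvd f - [:c:] - smult d u}"
proof (cases rule: codim_2_conductor[OF A])
  case (2 g w)
  note quartic = this
  have "w * w \<in> A" by (intro subalgebra_mult A quartic)
  then obtain c d where "g dvd w * w - [:c:] - smult d w" using quartic(5) by blast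
  then obtain l m where lm: "g dvd (w - [:l:]) * (w - [:m:])" by (metis quadratic_factors)
  have shift: "degree (w - [:l:]) = degree w"
    unfolding diff_conv_add_uminus by (rule degree_add_eq_left) (use quartic(3) in simp)
  show ?thesis
  proof (cases "l = m")
    case True
    have "A = {f. \<exists>c d. g dvd f - [:c:] - smult d (w - [:l:])}"
      unfolding quartic(5) by (rule affine_change[of _ l 1]) auto
    moreover have "g dvd (w - [:l:]) * (w - [:l:])" using lm True by simp
    ultimately show ?thesis using nilpotent[of g "w - [:l:]"] quartic(1,3,4) shift by simp
  next
    case False
    define u where "u = smult (1 / (m - l)) (w - [:l:])"
    have w: "w = [:l:] + smult (m - l) u" using False by (simp add: u_def)
    have "u - 1 = smult (1 / (m - l)) (w - [:m:])"
      using False by (simp add: u_def one_pCons smult_diff_right smult_diff_left field_simps)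
    then have "u * (u - 1) = smult (1 / (m - l) * (1 / (m - l))) ((w - [:l:]) * (w - [:m:]))"
      by (simp only: u_def mult_smult_left mult_smult_right smult_smult)
    then have "g dvd u * (u - 1)" using lm by (simp only: dvd_smult)
    moreover have "A = {f. \<exists>c d. g dvd f - [:c:] - smult d u}"
      unfolding quartic(5) by (rule affine_change[OF w]) (use False in auto)
    moreover have "degree u = degree w" using False shift by (simp add: u_def)
    ultimately show ?thesis using idempotent[of g u] quartic(1,3,4) by simp
  qed
qed (use that(1) in blast)

lemma degree_1_dvd_iff_root:
  fixes l :: "'a::field poly"
  assumes "degree l = 1"
  obtains z where "\<And>f. l dvd f \<longleftrightarrow> poly f z = 0"
proof -
  obtain b a where l: "l = [:b, a:]" "a \<noteq> 0" using degree1_coeffs[OF assms] by metis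
  define z where "z = - b / a"
  have "l = smult a [:-z, 1:]" using l by (simp add: z_def)
  then have dvd: "l dvd f \<longleftrightarrow> poly f z = 0" for f
    using l(2) by (simp only: poly_eq_0_iff_dvd smult_dvd_iff if_False)
  show ?thesis by (rule that[of z]) (rule dvd)
qed

lemma quadratic_split:
  fixes p :: "'a::alg_closed_field poly"
  assumes "degree p = 2"
  obtains k a b where "k \<noteq> 0" "p = smult k ([:-a, 1:] * [:-b, 1:])"
proof -
  obtain a where "poly p a = 0" using alg_closed_imp_poly_has_root[of p] assms by auto
  then obtain q where q: "p = [:-a, 1:] * q" by (auto simp: poly_eq_0_iff_dvd dvd_def)
  then have "q \<noteq> 0" using assms by auto
  then have "degree q = 1" using assms by (simp add: q degree_mult_eq del: mult_pCons_left)
  then obtain b where b: "poly q b = 0" using alg_closed_imp_poly_has_root[of q] by auto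
  then obtain r where r: "q = [:-b, 1:] * r" by (auto simp: poly_eq_0_iff_dvd dvd_def)
  have "r \<noteq> 0" using r \<open>q \<noteq> 0\<close> by auto
  then have "degree r = 0" using \<open>degree q = 1\<close> by (simp add: r degree_mult_eq del: mult_pCons_left)
  then obtain k where k: "r = [:k:]" by (rule degree_eq_zeroE)
  show ?thesis
  proof (rule that)
    show "k \<noteq> 0" using k \<open>r \<noteq> 0\<close> by auto
    show "p = smult k ([:-a, 1:] * [:-b, 1:])" unfolding q r k by (simp add: algebra_simps)
  qed
qed

lemma cubic_split:
  fixes p :: "'a::alg_closed_field poly"
  assumes "degree p = 3"
  obtains k a b c where "k \<noteq> 0" "p = smult k ([:-a, 1:] * [:-b, 1:] * [:-c, 1:])"
proof -
  obtain a where "poly p a = 0" using alg_closed_imp_poly_has_root[of p] assms by auto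
  then obtain q where q: "p = [:-a, 1:] * q" by (auto simp: poly_eq_0_iff_dvd dvd_def)
  then have "q \<noteq> 0" using assms by auto
  then have "degree q = 2" using assms by (simp add: q degree_mult_eq del: mult_pCons_left)
  then obtain k b c where "k \<noteq> 0" "q = smult k ([:-b, 1:] * [:-c, 1:])" by (rule quadratic_split)
  then show ?thesis using q
    by (intro that[of k a b c]) (simp_all only: mult.assoc mult_smult_right not_False_eq_True)
qed

text \<open>
  The algebra \<open>K + K u + (h l)\<close> is contained in \<open>K + (h)\<close> because \<open>h\<close> divides \<open>u\<close>. The two are equal
  because \<open>(h)/(h l)\<close> is one-dimensional and the class of \<open>u\<close> in it is nonzero.
\<close>

lemma const_mod_cubic_if_large_common_divisor:
  fixes g h u :: "'a::field poly"
  assumes g: "g = h * l" "degree l = 1" and h: "h dvd u" and u: "\<not> g dvd u"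
  shows "{f. \<exists>c d. g dvd f - [:c:] - smult d u} = const_mod h"
proof (intro set_eqI iffI)
  fix f assume "f \<in> {f. \<exists>c d. g dvd f - [:c:] - smult d u}"
  then obtain c d where "g dvd f - [:c:] - smult d u" by blast
  then have "h dvd f - [:c:] - smult d u" using g(1) dvd_mult_left by blast
  then have "h dvd (f - [:c:] - smult d u) + smult d u" using h by (intro dvd_add dvd_smult)
  then show "f \<in> const_mod h" by (auto simp: const_mod_def)
next
  fix f assume "f \<in> const_mod h"
  then obtain c k where k: "f - [:c:] = h * k" by (auto simp: const_mod_def dvd_def)
  obtain m where m: "u = h * m" using h by (auto simp: dvd_def)
  obtain z where z: "\<And>f. l dvd f \<longleftrightarrow> poly f z = 0"
    using degree_1_dvd_iff_root[OF g(2)] by blast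
  have "\<not> l dvd m" using u unfolding g(1) m by (meson dvd_refl mult_dvd_mono)
  then have mz: "poly m z \<noteq> 0" using z by blast
  \<comment> \<open>Chosen so that \<open>k - d m\<close> vanishes at the root of \<open>l\<close>.\<close>
  define d where "d = poly k z / poly m z"
  have "l dvd k - smult d m" unfolding z using mz by (simp add: d_def)
  then have "g dvd h * (k - smult d m)" unfolding g(1) by simp
  also have "h * (k - smult d m) = f - [:c:] - smult d u" by (simp add: k m algebra_simps)
  finally show "f \<in> {f. \<exists>c d. g dvd f - [:c:] - smult d u}" by blast
qed

text \<open>
  Write \<open>g = g1 * g2\<close> with both factors dividing \<open>u\<close>. If one of them is cubic, or if a cubic divisor
  of \<open>g\<close> divides \<open>u\<close> for another reason, the previous lemma applies. What remains is \<open>g1\<close> and \<open>g2\<close>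
  quadratic with the same roots.
\<close>

lemma nilpotent_form:
  fixes g u :: "'a::alg_closed_field poly"
  assumes g: "degree g = 4" and u: "0 < degree u" "degree u < 4" and dvd: "g dvd u * u"
    and A: "A = {f. \<exists>c d. g dvd f - [:c:] - smult d u}"
  obtains (cubic) h where "degree h = 3" "A = const_mod h"
  | (square) h m a b where "h = [:-a, 1:] * [:-b, 1:]" "poly m a \<noteq> 0" "poly m b \<noteq> 0"
      "A = {f. \<exists>c d. h * h dvd f - [:c:] - smult d (h * m)}"
proof -
  have g0: "g \<noteq> 0" using g by auto
  have u0: "u \<noteq> 0" using u by auto
  have ndvd: "\<not> g dvd u" using dvd_imp_degree_le[of g u] u0 g u by auto
  obtain g1 g2 where g12: "g = g1 * g2" "g1 dvd u" "g2 dvd u"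
    using dvd_mult_split[OF dvd g0] by blast
  have n0: "g1 \<noteq> 0" "g2 \<noteq> 0" using g12 g0 by auto
  have deg: "degree g1 + degree g2 = 4" using g n0 g12 by (simp add: degree_mult_eq)
  have "degree g1 \<le> 3" "degree g2 \<le> 3"
    using dvd_imp_degree_le[OF g12(2) u0] dvd_imp_degree_le[OF g12(3) u0] u by auto
  then consider "degree g1 = 3" "degree g2 = 1" | "degree g2 = 3" "degree g1 = 1"
    | "degree g1 = 2" "degree g2 = 2" using deg by linarith
  then show ?thesis
  proof cases
    case 1
    have "A = const_mod g1"
      unfolding A using 1 by (intro const_mod_cubic_if_large_common_divisor[OF g12(1) _ g12(2) ndvd])
    then show ?thesis using cubic 1 by blast
  next
    case 2
    have "g = g2 * g1" using g12 by (simp add: mult.commute)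
    then have "A = const_mod g2"
      unfolding A using 2 by (intro const_mod_cubic_if_large_common_divisor[OF _ _ g12(3) ndvd])
    then show ?thesis using cubic 2 by blast
  next
    case 3
    obtain k a b where k: "k \<noteq> 0" "g1 = smult k ([:-a, 1:] * [:-b, 1:])"
      using quadratic_split 3 by metis
    obtain j c d where j: "j \<noteq> 0" "g2 = smult j ([:-c, 1:] * [:-d, 1:])"
      using quadratic_split 3 by metis
    define X where "X = (\<lambda>a::'a. [:-a, 1:])"
    have dX: "degree (X a) = 1" and X0: "X a \<noteq> 0" and pX: "poly (X a) z = z - a" for a z
      by (auto simp: X_def)
    define g' where "g' = X a * X b * X c * X d"
    have gg: "g = smult (k * j) g'"
      unfolding g12 k j g'_def X_def by (simp only: mult_smult_left mult_smult_right smult_smult mult_ac)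
    have gdvd: "g dvd f \<longleftrightarrow> g' dvd f" for f
      unfolding gg using k j by (simp add: smult_dvd_iff)
    have A': "A = {f. \<exists>c d. g' dvd f - [:c:] - smult d u}" unfolding A gdvd ..
    have "X a * X b dvd u" "X c * X d dvd u"
      using g12 k j by (simp_all only: X_def smult_dvd_iff if_False)
    then obtain m n where m: "u = X a * X b * m" and n: "u = X c * X d * n"
      unfolding dvd_def by blast
    \<comment> \<open>A further root \<open>e\<close> of \<open>g2\<close> in \<open>m = u / g1\<close> gives the cubic common
      divisor \<open>g1 (x - e)\<close> of \<open>g\<close> and \<open>u\<close>.\<close>
    show ?thesis
    proof (cases "poly m c = 0 \<or> poly m d = 0")
      case True
      then obtain e e' where e: "poly m e = 0" "g' = X a * X b * X e * X e'"
      proof (cases "poly m c = 0")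
        case True
        then show ?thesis using that[of c d] by (simp only: g'_def)
      next
        case False
        moreover have "g' = X a * X b * X d * X c" by (simp only: g'_def mult_ac)
        ultimately show ?thesis using that[of d c] \<open>poly m c = 0 \<or> poly m d = 0\<close> by blast
      qed
      then obtain m' where "m = X e * m'" by (auto simp: X_def poly_eq_0_iff_dvd dvd_def)
      then have "X a * X b * X e dvd u" unfolding m by (simp add: mult.assoc)
      then have "A = const_mod (X a * X b * X e)"
        unfolding A' using dX ndvd
        by (intro const_mod_cubic_if_large_common_divisor[OF e(2)]) (simp_all only: gdvd not_False_eq_True)
      moreover have "degree (X a * X b * X e) = 3" by (simp add: degree_mult_eq X0 dX)
      ultimately show ?thesis using cubic by blast
    next
      case False
      have "poly u c = 0" "poly u d = 0" unfolding n by (auto simp: pX)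
      then have cd: "c = a \<or> c = b" "d = a \<or> d = b" using False unfolding m by (auto simp: pX)
      have "(c = a \<and> d = b) \<or> (c = b \<and> d = a)"
      proof (rule ccontr)
        assume neg: "\<not> ?thesis"
        \<comment> \<open>Otherwise \<open>c = d\<close> is a simple root of \<open>g1\<close>, and \<open>g2\<close>, a multiple
          of \<open>(x - c)^2\<close>, divides \<open>u\<close>; hence \<open>m(c) = 0\<close>, which is excluded
          here.\<close>
        define e where "e = (if c = a then b else a)"
        have e: "c = d" "c \<noteq> e" "X a * X b = X c * X e" using neg cd by (auto simp: e_def mult.commute)
        have "X c * (X e * m) = X c * (X c * n)" using m n e by (simp only: mult.assoc)
        then have "X e * m = X c * n" using X0[of c] mult_left_cancel by blast
        then have "poly (X e * m) c = poly (X c * n) c" by simp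
        then show False using False e by (simp add: pX)
      qed
      then have "poly m a \<noteq> 0" "poly m b \<noteq> 0" and g': "g' = (X a * X b) * (X a * X b)"
        using False unfolding g'_def by (auto simp only: mult_ac)
      then show ?thesis
        by (intro square[of "X a * X b" a b m]) (simp_all only: A' m X_def mult.assoc not_False_eq_True)
    qed
  qed
qed

lemma const_mod_linear:
  assumes "degree g = 1"
  shows "const_mod g = UNIV"
proof -
  obtain z where z: "\<And>f. g dvd f \<longleftrightarrow> poly f z = 0"
    using degree_1_dvd_iff_root[OF assms] by metis
  have "g dvd f - [:poly f z:]" for f unfolding z by simp
  then show ?thesis unfolding const_mod_def by blast
qed

text \<open>
  The factors of \<open>g\<close> dividing \<open>u\<close> and \<open>u - 1\<close> have no common root, and \<open>u\<close> itself provides the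
  Chinese remainder: it is 0 modulo one factor and 1 modulo the other, so the combinations
  \<open>c + d u\<close> realize every pair of constants modulo the two factors.
\<close>

lemma idempotent_form:
  fixes g u :: "'a::alg_closed_field poly"
  assumes g: "degree g = 4" and u: "0 < degree u" "degree u < 4" and dvd: "g dvd u * (u - 1)"
    and A: "A = {f. \<exists>c d. g dvd f - [:c:] - smult d u}"
  obtains (cubic) h where "degree h = 3" "A = const_mod h"
  | (coprime) g0 g1 where "degree g0 = 2" "degree g1 = 2" "\<And>z. \<not> (poly g0 z = 0 \<and> poly g1 z = 0)"
      "A = const_mod g0 \<inter> const_mod g1"
proof -
  have gn: "g \<noteq> 0" using g by auto
  have du: "degree (u - 1) = degree u"
    using degree_add_eq_left[of "-1" u] u by simp
  then have un: "u \<noteq> 0" "u - 1 \<noteq> 0" using u by force+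
  obtain g0 g1 where g01: "g = g0 * g1" "g0 dvd u" "g1 dvd u - 1"
    using dvd_mult_split[OF dvd gn] by blast
  have n0: "g0 \<noteq> 0" "g1 \<noteq> 0" using g01 gn by auto
  have deg: "degree g0 + degree g1 = 4" using g n0 g01 by (simp add: degree_mult_eq)
  have le: "degree g0 \<le> 3" "degree g1 \<le> 3"
    using dvd_imp_degree_le[OF g01(2) un(1)] dvd_imp_degree_le[OF g01(3) un(2)] u du by auto
  have no_common: "\<not> (poly g0 z = 0 \<and> poly g1 z = 0)" for z
  proof
    assume z: "poly g0 z = 0 \<and> poly g1 z = 0"
    obtain k k' where "u = g0 * k" "u - 1 = g1 * k'" using g01(2,3) unfolding dvd_def by blast
    then have "poly u z = 0" "poly (u - 1) z = 0" using z by auto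
    then show False by simp
  qed
  have AI: "A = const_mod g0 \<inter> const_mod g1"
  proof (intro set_eqI iffI)
    fix f assume "f \<in> A"
    then obtain c d where cd: "g dvd f - [:c:] - smult d u" unfolding A by blast
    then have "g0 dvd f - [:c:] - smult d u" "g1 dvd f - [:c:] - smult d u"
      unfolding g01(1) using dvd_mult_left dvd_mult_right by blast+
    then have "g0 dvd (f - [:c:] - smult d u) + smult d u"
      "g1 dvd (f - [:c:] - smult d u) + smult d (u - 1)"
      using g01 by (blast intro: dvd_add dvd_smult)+
    moreover have "(f - [:c:] - smult d u) + smult d u = f - [:c:]" by simp
    moreover have "(f - [:c:] - smult d u) + smult d (u - 1) = f - [:c + d:]"
      by (simp add: smult_diff_right algebra_simps)
    ultimately have "g0 dvd f - [:c:]" "g1 dvd f - [:c + d:]" by (simp_all only:)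
    then show "f \<in> const_mod g0 \<inter> const_mod g1" unfolding const_mod_def by blast
  next
    fix f assume "f \<in> const_mod g0 \<inter> const_mod g1"
    then obtain c c' where c: "g0 dvd f - [:c:]" "g1 dvd f - [:c':]" unfolding const_mod_def by blast
    define F where "F = f - [:c:] - smult (c' - c) u"
    have 0: "g0 dvd F" unfolding F_def using dvd_diff[OF c(1) dvd_smult[OF g01(2)]] .
    have "F = (f - [:c':]) - smult (c' - c) (u - 1)"
      by (simp add: F_def smult_diff_right one_pCons)
    then have 1: "g1 dvd F" using dvd_diff[OF c(2) dvd_smult[OF g01(3)]] by simp
    \<comment> \<open>Combine \<open>F = u F - (u - 1) F\<close>: each term is divisible by both factors.\<close>
    have "g0 * g1 dvd u * F" "g0 * g1 dvd F * (u - 1)"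
      by (intro mult_dvd_mono g01 0 1)+
    then have "g0 * g1 dvd u * F - F * (u - 1)" by (rule dvd_diff)
    also have "u * F - F * (u - 1) = F" by (simp add: algebra_simps)
    finally show "f \<in> A" unfolding A F_def g01(1) by blast
  qed
  consider "degree g0 = 1" "degree g1 = 3" | "degree g0 = 3" "degree g1 = 1"
    | "degree g0 = 2" "degree g1 = 2" using deg le by linarith
  then show ?thesis
  proof cases
    case 1
    then show ?thesis using cubic[of g1] AI const_mod_linear[of g0] by simp
  next
    case 2
    then show ?thesis using cubic[of g0] AI const_mod_linear[of g1] by simp
  next
    case 3
    then show ?thesis using coprime[of g0 g1] AI no_common by blast
  qed
qed

section \<open>Divisibility by linear factors as conditions at points\<close>

text \<open>
  Synthetic division removes one linear factor, so that conditions for divisibility by a product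
  can be computed factor by factor. The values of the quotient are expressed through those of \<open>f\<close> by
  the next lemma.
\<close>

lemma linear_mult_dvd_iff:
  fixes f k :: "'a::field poly"
  shows "[:-a, 1:] * k dvd f \<longleftrightarrow> poly f a = 0 \<and> k dvd synthetic_div f a"
proof -
  have f: "f = [:-a, 1:] * synthetic_div f a + [:poly f a:]"
    using synthetic_div_correct'[of a f] by simp
  show ?thesis
  proof
    assume d: "[:-a, 1:] * k dvd f"
    then have 0: "poly f a = 0" using dvd_mult_left poly_eq_0_iff_dvd by blast
    then have "f = [:-a, 1:] * synthetic_div f a" using f by simp
    then have "[:-a, 1:] * k dvd [:-a, 1:] * synthetic_div f a" using d by metis
    then show "poly f a = 0 \<and> k dvd synthetic_div f a"
      using 0 by (subst (asm) dvd_mult_cancel_left) simp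
  next
    assume "poly f a = 0 \<and> k dvd synthetic_div f a"
    then show "[:-a, 1:] * k dvd f" using f by (metis add.right_neutral dvd_refl mult_dvd_mono pCons_0_0)
  qed
qed

text \<open>
  Leibniz' rule for \<open>f = f(a) + (x - a) q\<close>, where \<open>q\<close> is the quotient.
\<close>

lemma synthetic_div_taylor:
  fixes f :: "'a::field poly"
  shows "poly f z = poly f a + (z - a) * poly (synthetic_div f a) z"
    and "poly (pderiv f) z = poly (synthetic_div f a) z + (z - a) * poly (pderiv (synthetic_div f a)) z"
    and "poly (pderiv (pderiv f)) a = 2 * poly (pderiv (synthetic_div f a)) a"
    and "poly (pderiv (pderiv (pderiv f))) a = 3 * poly (pderiv (pderiv (synthetic_div f a))) a"
proof -
  define q where "q = synthetic_div f a"
  have f: "f = [:-a, 1:] * q + [:poly f a:]"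
    using synthetic_div_correct'[of a f] unfolding q_def by simp
  have f1: "pderiv f = [:-a, 1:] * pderiv q + q"
    by (subst f) (simp add: pderiv_add pderiv_mult pderiv_pCons del: mult_pCons_left)
  have f2: "pderiv (pderiv f) = [:-a, 1:] * pderiv (pderiv q) + 2 * pderiv q"
    unfolding f1 by (simp add: pderiv_add pderiv_mult pderiv_pCons del: mult_pCons_left)
  have f3: "pderiv (pderiv (pderiv f)) = [:-a, 1:] * pderiv (pderiv (pderiv q)) + 3 * pderiv (pderiv q)"
    unfolding f2 by (simp add: pderiv_add pderiv_mult pderiv_pCons del: mult_pCons_left)
  show "poly f z = poly f a + (z - a) * poly (synthetic_div f a) z"
    unfolding q_def[symmetric] by (subst f) (simp add: algebra_simps)
  show "poly (pderiv f) z = poly (synthetic_div f a) z + (z - a) * poly (pderiv (synthetic_div f a)) z"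
    unfolding q_def[symmetric] f1 by (simp add: algebra_simps)
  show "poly (pderiv (pderiv f)) a = 2 * poly (pderiv (synthetic_div f a)) a"
    unfolding q_def[symmetric] f2 by simp
  show "poly (pderiv (pderiv (pderiv f))) a = 3 * poly (pderiv (pderiv (synthetic_div f a))) a"
    unfolding q_def[symmetric] f3 by simp
qed

lemma linear_dvd_iff: "[:-a, 1:] dvd f \<longleftrightarrow> poly f a = 0" for a :: "'a::field"
  by (simp add: poly_eq_0_iff_dvd)

lemma dvd_two_points:
  fixes f :: "'a::field poly"
  assumes "a \<noteq> b"
  shows "[:-a, 1:] * [:-b, 1:] dvd f \<longleftrightarrow> poly f a = 0 \<and> poly f b = 0"
  using synthetic_div_taylor(1)[of f b a] assms
  unfolding linear_mult_dvd_iff linear_dvd_iff by auto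

lemma dvd_double_point:
  fixes f :: "'a::field poly"
  shows "[:-a, 1:] * [:-a, 1:] dvd f \<longleftrightarrow> poly f a = 0 \<and> poly (pderiv f) a = 0"
  using synthetic_div_taylor(2)[of f a a]
  unfolding linear_mult_dvd_iff linear_dvd_iff by auto

lemma dvd_three_points:
  fixes f :: "'a::field poly"
  assumes "a \<noteq> b" "a \<noteq> c" "b \<noteq> c"
  shows "[:-a, 1:] * ([:-b, 1:] * [:-c, 1:]) dvd f \<longleftrightarrow> poly f a = 0 \<and> poly f b = 0 \<and> poly f c = 0"
  using synthetic_div_taylor(1)[of f b a] synthetic_div_taylor(1)[of f c a] assms
  unfolding linear_mult_dvd_iff[of a] dvd_two_points[OF assms(3)] by auto

lemma dvd_double_and_simple_point:
  fixes f :: "'a::field poly"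
  assumes "a \<noteq> b"
  shows "[:-a, 1:] * ([:-a, 1:] * [:-b, 1:]) dvd f \<longleftrightarrow>
    poly f a = 0 \<and> poly (pderiv f) a = 0 \<and> poly f b = 0"
  using synthetic_div_taylor(2)[of f a a] synthetic_div_taylor(1)[of f b a] assms
  unfolding linear_mult_dvd_iff[of a "_ * _"] dvd_two_points[OF assms] by auto

lemma dvd_triple_point:
  fixes f :: "'a::field_char_0 poly"
  shows "[:-a, 1:] * ([:-a, 1:] * [:-a, 1:]) dvd f \<longleftrightarrow>
    poly f a = 0 \<and> poly (pderiv f) a = 0 \<and> poly (pderiv (pderiv f)) a = 0"
  using synthetic_div_taylor(2)[of f a a] synthetic_div_taylor(3)[of f a]
  unfolding linear_mult_dvd_iff[of a "_ * _"] dvd_double_point by auto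

text \<open>
  The factors are ordered so that removing the first leaves the pattern of the double and simple point
  with the roles of \<open>a\<close> and \<open>b\<close> exchanged.
\<close>

lemma dvd_two_double_points:
  fixes f :: "'a::field poly"
  assumes "a \<noteq> b"
  shows "[:-a, 1:] * ([:-b, 1:] * ([:-b, 1:] * [:-a, 1:])) dvd f \<longleftrightarrow>
    poly f a = 0 \<and> poly (pderiv f) a = 0 \<and> poly f b = 0 \<and> poly (pderiv f) b = 0"
  using synthetic_div_taylor(2)[of f a a] synthetic_div_taylor(1)[of f b a]
    synthetic_div_taylor(2)[of f b a] assms
  unfolding linear_mult_dvd_iff[of a "_ * _"] dvd_double_and_simple_point[OF assms[symmetric]]
  by auto

lemma dvd_quadruple_point:
  fixes f :: "'a::field_char_0 poly"
  shows "[:-a, 1:] * ([:-a, 1:] * ([:-a, 1:] * [:-a, 1:])) dvd f \<longleftrightarrow>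
    poly f a = 0 \<and> poly (pderiv f) a = 0 \<and> poly (pderiv (pderiv f)) a = 0 \<and>
    poly (pderiv (pderiv (pderiv f))) a = 0"
  using synthetic_div_taylor(2)[of f a a] synthetic_div_taylor(3,4)[of f a]
  unfolding linear_mult_dvd_iff[of a "_ * (_ * _)"] dvd_triple_point by auto

lemma const_mod_two_points:
  fixes a b :: "'a::field"
  assumes "a \<noteq> b"
  shows "const_mod ([:-a, 1:] * [:-b, 1:]) = {f. poly f a = poly f b}"
  unfolding const_mod_def dvd_two_points[OF assms] by auto

lemma const_mod_double_point:
  fixes a :: "'a::field"
  shows "const_mod ([:-a, 1:] * [:-a, 1:]) = {f. poly (pderiv f) a = 0}"
  unfolding const_mod_def dvd_double_point by (auto simp: pderiv_diff pderiv_pCons)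

lemma const_mod_three_points:
  fixes a b c :: "'a::field"
  assumes "a \<noteq> b" "a \<noteq> c" "b \<noteq> c"
  shows "const_mod ([:-a, 1:] * ([:-b, 1:] * [:-c, 1:])) = {f. poly f a = poly f b \<and> poly f b = poly f c}"
  unfolding const_mod_def dvd_three_points[OF assms] by auto

lemma const_mod_double_and_simple_point:
  fixes a b :: "'a::field"
  assumes "a \<noteq> b"
  shows "const_mod ([:-a, 1:] * ([:-a, 1:] * [:-b, 1:])) =
    {f. poly f a = poly f b \<and> poly (pderiv f) a = 0}"
  unfolding const_mod_def dvd_double_and_simple_point[OF assms]
  by (auto simp: pderiv_diff pderiv_pCons)

lemma const_mod_triple_point:
  fixes a :: "'a::field_char_0"
  shows "const_mod ([:-a, 1:] * ([:-a, 1:] * [:-a, 1:])) =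
    {f. poly (pderiv f) a = 0 \<and> poly (pderiv (pderiv f)) a = 0}"
  unfolding const_mod_def dvd_triple_point by (auto simp: pderiv_diff pderiv_pCons)

text \<open>
  Modulo \<open>h * h\<close>, a polynomial \<open>f\<close> is known through its value and first derivative at \<open>a\<close> and \<open>b\<close>.
  Membership says that the values agree and that the vector of derivatives is a multiple of that of
  \<open>h * m\<close>, which is \<open>((a - b) m(a), (b - a) m(b))\<close>.
\<close>

lemma square_form_two_points:
  fixes a b :: "'a::field"
  assumes ab: "a \<noteq> b" and h: "h = [:-a, 1:] * [:-b, 1:]" and m: "poly m a \<noteq> 0" "poly m b \<noteq> 0"
  shows "{f. \<exists>c d. h * h dvd f - [:c:] - smult d (h * m)} =
    {f. poly f a = poly f b \<and> poly m b * poly (pderiv f) a + poly m a * poly (pderiv f) b = 0}"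
proof -
  have hh: "h * h = [:-a, 1:] * ([:-b, 1:] * ([:-b, 1:] * [:-a, 1:]))"
    unfolding h by (simp only: mult.assoc mult.commute)
  have h0: "poly h a = 0" "poly h b = 0" by (simp_all add: h)
  have h1: "poly (pderiv h) a = a - b" "poly (pderiv h) b = b - a"
    by (simp_all add: h pderiv_mult pderiv_pCons)
  have "(\<exists>c d. h * h dvd f - [:c:] - smult d (h * m)) \<longleftrightarrow>
      poly f a = poly f b \<and> (\<exists>d. poly (pderiv f) a = d * ((a - b) * poly m a) \<and>
        poly (pderiv f) b = d * ((b - a) * poly m b))" for f
    unfolding hh dvd_two_double_points[OF ab]
    by (auto simp: pderiv_diff pderiv_smult pderiv_mult pderiv_pCons h0 h1)
  moreover have "(\<exists>d. poly (pderiv f) a = d * ((a - b) * poly m a) \<and>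
        poly (pderiv f) b = d * ((b - a) * poly m b)) \<longleftrightarrow>
      poly m b * poly (pderiv f) a + poly m a * poly (pderiv f) b = 0" (is "?L \<longleftrightarrow> ?R") for f
  proof
    assume ?L
    then obtain d where d: "poly (pderiv f) a = d * ((a - b) * poly m a)"
      "poly (pderiv f) b = d * ((b - a) * poly m b)" by blast
    show ?R unfolding d by (simp add: algebra_simps)
  next
    assume R: ?R
    define d where "d = poly (pderiv f) a / ((a - b) * poly m a)"
    have da: "poly (pderiv f) a = d * ((a - b) * poly m a)" using ab m by (simp add: d_def)
    have "poly m a * poly (pderiv f) b = poly m a * (d * ((b - a) * poly m b))"
      using R unfolding da by algebra
    then show ?L using da m by auto
  qed
  ultimately show ?thesis by auto
qed

text \<open>
  Here \<open>h * m\<close> has a double zero at \<open>a\<close>, with second and third derivative \<open>2 m(a)\<close> and \<open>6 m'(a)\<close>.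
  Membership says that \<open>f'(a) = 0\<close> and that the pair of the next two derivatives of \<open>f\<close> at \<open>a\<close> is
  proportional to this one.
\<close>

lemma square_form_double_point:
  fixes a :: "'a::field_char_0"
  assumes h: "h = [:-a, 1:] * [:-a, 1:]" and m: "poly m a \<noteq> 0"
  shows "{f. \<exists>c d. h * h dvd f - [:c:] - smult d (h * m)} =
    {f. poly (pderiv f) a = 0 \<and>
      3 * poly (pderiv m) a * poly (pderiv (pderiv f)) a +
        - poly m a * poly (pderiv (pderiv (pderiv f))) a = 0}"
proof -
  have hh: "h * h = [:-a, 1:] * ([:-a, 1:] * ([:-a, 1:] * [:-a, 1:]))"
    unfolding h by (simp only: mult.assoc)
  have h0: "poly h a = 0" by (simp add: h)
  have h1: "pderiv h = 2 * [:-a, 1:]" "pderiv (pderiv h) = 2" "pderiv (pderiv (pderiv h)) = 0"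
    by (simp_all add: h pderiv_mult pderiv_pCons one_pCons numeral_poly)
  have "(\<exists>c d. h * h dvd f - [:c:] - smult d (h * m)) \<longleftrightarrow>
      poly (pderiv f) a = 0 \<and> (\<exists>d. poly (pderiv (pderiv f)) a = d * (2 * poly m a) \<and>
        poly (pderiv (pderiv (pderiv f))) a = d * (6 * poly (pderiv m) a))" for f
    unfolding hh dvd_quadruple_point
    by (auto simp: pderiv_diff pderiv_add pderiv_smult pderiv_mult pderiv_pCons h0 h1)
  moreover have "(\<exists>d. poly (pderiv (pderiv f)) a = d * (2 * poly m a) \<and>
        poly (pderiv (pderiv (pderiv f))) a = d * (6 * poly (pderiv m) a)) \<longleftrightarrow>
      3 * poly (pderiv m) a * poly (pderiv (pderiv f)) a +
        - poly m a * poly (pderiv (pderiv (pderiv f))) a = 0" (is "?L \<longleftrightarrow> ?R") for f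
  proof
    assume ?L
    then show ?R by (auto simp: algebra_simps)
  next
    assume R: ?R
    define d where "d = poly (pderiv (pderiv f)) a / (2 * poly m a)"
    have da: "poly (pderiv (pderiv f)) a = d * (2 * poly m a)" using m by (simp add: d_def)
    have "poly m a * poly (pderiv (pderiv (pderiv f))) a = poly m a * (d * (6 * poly (pderiv m) a))"
      using R unfolding da by algebra
    then show ?L using da m by auto
  qed
  ultimately show ?thesis by auto
qed

section \<open>The list of algebras and their spectra\<close>

text \<open>
  Away from the roots of \<open>g\<close> the ideal \<open>(g)\<close> separates points and tangent directions: if
  \<open>g(z) \<noteq> 0\<close>, then \<open>g (x - z)\<close> has nonzero derivative at \<open>z\<close>, and \<open>g (x - y)\<close> vanishes at \<open>y\<close> but not
  at \<open>z\<close>.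
\<close>

lemma spectrum_subset_roots:
  assumes "\<And>k. g * k \<in> A"
  shows "spectrum A \<subseteq> {z. poly g z = 0}"
proof
  fix z assume z: "z \<in> spectrum A"
  show "z \<in> {z. poly g z = 0}"
  proof (cases "\<forall>f\<in>A. poly (pderiv f) z = 0")
    case True
    then have "poly (pderiv (g * [:-z, 1:])) z = 0" using assms by blast
    then show ?thesis by (simp add: pderiv_mult pderiv_pCons del: mult_pCons_right)
  next
    case False
    then obtain y where y: "y \<noteq> z" "\<forall>f\<in>A. poly f z = poly f y"
      using z unfolding spectrum_def by blast
    then have "poly (g * [:-y, 1:]) z = poly (g * [:-y, 1:]) y" using assms by blast
    then show ?thesis using y(1) by (simp del: mult_pCons_right)
  qed
qed

lemma spectrumI_value: "a \<noteq> b \<Longrightarrow> (\<And>f. f \<in> A \<Longrightarrow> poly f a = poly f b) \<Longrightarrow> {a, b} \<subseteq> spectrum A"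
  unfolding spectrum_def by (auto dest: not_sym)

lemma spectrumI_deriv: "(\<And>f. f \<in> A \<Longrightarrow> poly (pderiv f) a = 0) \<Longrightarrow> {a} \<subseteq> spectrum A"
  unfolding spectrum_def by auto

lemma mult_in_const_mod: "h dvd g \<Longrightarrow> g * k \<in> const_mod h"
  unfolding const_mod_def by (auto intro!: exI[of _ 0] dvd_mult2)

lemma const_mod_smult: "k \<noteq> 0 \<Longrightarrow> const_mod (smult k h) = const_mod h"
  unfolding const_mod_def by (simp add: smult_dvd_iff)

text \<open>
  The six families are named after the singularities of the curve with coordinate ring \<open>A\<close>, whose
  normalization is the affine line: gluing two points makes a node, a vanishing derivative makes a
  cusp, and a linear relation with nonzero coefficients between the derivatives at two glued points
  makes the branches of the node tangent.
\<close>

definition one_point_algebra where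
  "one_point_algebra \<alpha> a b = {f. poly (pderiv f) \<alpha> = 0 \<and>
    a * poly (pderiv (pderiv f)) \<alpha> + b * poly (pderiv (pderiv (pderiv f))) \<alpha> = (0 :: 'a :: field)}"

definition tangent_algebra where
  "tangent_algebra \<alpha> \<beta> a b = {f. poly f \<alpha> = poly f \<beta> \<and>
    a * poly (pderiv f) \<alpha> + b * poly (pderiv f) \<beta> = (0 :: 'a :: field)}"

definition two_cusp_algebra where
  "two_cusp_algebra \<alpha> \<beta> = {f. poly (pderiv f) \<alpha> = 0 \<and> poly (pderiv f) \<beta> = (0 :: 'a :: field)}"

definition node_cusp_algebra where
  "node_cusp_algebra \<alpha> \<beta> \<gamma> = {f. poly f \<alpha> = poly f \<beta> \<and> poly (pderiv f) \<gamma> = (0 :: 'a :: field)}"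

definition triple_point_algebra where
  "triple_point_algebra \<alpha> \<beta> \<gamma> = {f. poly f \<alpha> = poly f \<beta> \<and> poly f \<beta> = (poly f \<gamma> :: 'a :: field)}"

definition two_node_algebra where
  "two_node_algebra \<alpha> \<beta> \<gamma> \<delta> = {f. poly f \<alpha> = poly f \<beta> \<and> poly f \<gamma> = (poly f \<delta> :: 'a :: field)}"

lemmas algebra_defs = one_point_algebra_def tangent_algebra_def two_cusp_algebra_def
  node_cusp_algebra_def triple_point_algebra_def two_node_algebra_def

text \<open>
  Phrased as an inductive predicate, the six-fold disjunction is accessible through its introduction
  rules and through case analysis.
\<close>

inductive catalogued :: "'a::field poly set \<Rightarrow> bool" where
  one_point: "spectrum A = {\<alpha>} \<Longrightarrow> a \<noteq> 0 \<or> b \<noteq> 0 \<Longrightarrow> A = one_point_algebra \<alpha> a b \<Longrightarrow> catalogued A"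
| tangent: "distinct [\<alpha>, \<beta>] \<Longrightarrow> spectrum A = {\<alpha>, \<beta>} \<Longrightarrow> a \<noteq> 0 \<or> b \<noteq> 0 \<Longrightarrow>
    A = tangent_algebra \<alpha> \<beta> a b \<Longrightarrow> catalogued A"
| two_cusp: "distinct [\<alpha>, \<beta>] \<Longrightarrow> spectrum A = {\<alpha>, \<beta>} \<Longrightarrow> A = two_cusp_algebra \<alpha> \<beta> \<Longrightarrow> catalogued A"
| node_cusp: "distinct [\<alpha>, \<beta>, \<gamma>] \<Longrightarrow> spectrum A = {\<alpha>, \<beta>, \<gamma>} \<Longrightarrow>
    A = node_cusp_algebra \<alpha> \<beta> \<gamma> \<Longrightarrow> catalogued A"
| triple: "distinct [\<alpha>, \<beta>, \<gamma>] \<Longrightarrow> spectrum A = {\<alpha>, \<beta>, \<gamma>} \<Longrightarrow>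
    A = triple_point_algebra \<alpha> \<beta> \<gamma> \<Longrightarrow> catalogued A"
| two_node: "distinct [\<alpha>, \<beta>, \<gamma>, \<delta>] \<Longrightarrow> spectrum A = {\<alpha>, \<beta>, \<gamma>, \<delta>} \<Longrightarrow>
    A = two_node_algebra \<alpha> \<beta> \<gamma> \<delta> \<Longrightarrow> catalogued A"

text \<open>
  The three root patterns of the cubic: a triple root gives the case \<open>f'(a) = f''(a) = 0\<close>, a double
  and a simple root the case \<open>f(a) = f(b), f'(a) = 0\<close>, and three distinct roots a triple point.
\<close>

lemma catalogued_const_mod_cubic:
  fixes h :: "'a::{alg_closed_field, field_char_0} poly"
  assumes "degree h = 3"
  shows "catalogued (const_mod h)"
proof -
  define X where "X = (\<lambda>a::'a. [:-a, 1:])"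
  have pX: "poly (X a) z = z - a" for a z by (simp add: X_def)
  have double: "catalogued (const_mod (X a * (X a * X b)))" if "a \<noteq> b" for a b
  proof (rule catalogued.tangent[where \<alpha> = a and \<beta> = b and a = 1 and b = 0])
    let ?A = "const_mod (X a * (X a * X b))"
    have A: "?A = {f. poly f a = poly f b \<and> poly (pderiv f) a = 0}"
      unfolding X_def by (rule const_mod_double_and_simple_point[OF that])
    then show "?A = tangent_algebra a b 1 0" by (simp add: tangent_algebra_def)
    have "spectrum ?A \<subseteq> {z. poly (X a * (X a * X b)) z = 0}"
      by (rule spectrum_subset_roots) (simp add: mult_in_const_mod)
    also have "\<dots> \<subseteq> {a, b}" by (auto simp: pX)
    finally show "spectrum ?A = {a, b}" using spectrumI_value[OF that, of ?A] A by blast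
  qed (use that in simp_all)
  obtain k a b c where k: "k \<noteq> 0" "h = smult k (X a * X b * X c)"
    using cubic_split[OF assms] unfolding X_def by metis
  then have h: "const_mod h = const_mod (X a * (X b * X c))"
    by (simp add: const_mod_smult mult.assoc)
  consider "a = b" "b = c" | "a = b" "b \<noteq> c" | "a = c" "b \<noteq> c" | "b = c" "a \<noteq> c"
    | "a \<noteq> b" "a \<noteq> c" "b \<noteq> c" by blast
  then show ?thesis
  proof cases
    case 1
    let ?A = "const_mod (X a * (X a * X a))"
    have A: "?A = {f. poly (pderiv f) a = 0 \<and> poly (pderiv (pderiv f)) a = 0}"
      unfolding X_def by (rule const_mod_triple_point)
    have "spectrum ?A \<subseteq> {z. poly (X a * (X a * X a)) z = 0}"
      by (rule spectrum_subset_roots) (simp add: mult_in_const_mod)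
    also have "\<dots> \<subseteq> {a}" by (auto simp: pX)
    finally have "spectrum ?A = {a}" using spectrumI_deriv[of ?A a] A by blast
    moreover have "?A = one_point_algebra a 1 0" using A by (simp add: one_point_algebra_def)
    ultimately have "catalogued ?A" by (intro catalogued.one_point[where \<alpha> = a and a = 1 and b = 0]) simp_all
    then show ?thesis using h 1 by simp
  next
    case 2
    then show ?thesis using h double[of b c] by simp
  next
    case 3
    then have "const_mod h = const_mod (X c * (X c * X b))" unfolding h by (simp add: mult_ac)
    then show ?thesis using double[of c b] 3 by simp
  next
    case 4
    then have "const_mod h = const_mod (X c * (X c * X a))" unfolding h by (simp add: mult_ac)
    then show ?thesis using double[of c a] 4 by simp
  next
    case 5
    let ?A = "const_mod (X a * (X b * X c))"
    have A: "?A = {f. poly f a = poly f b \<and> poly f b = poly f c}"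
      unfolding X_def by (rule const_mod_three_points[OF 5])
    have "spectrum ?A \<subseteq> {z. poly (X a * (X b * X c)) z = 0}"
      by (rule spectrum_subset_roots) (simp add: mult_in_const_mod)
    also have "\<dots> \<subseteq> {a, b, c}" by (auto simp: pX)
    finally have "spectrum ?A = {a, b, c}"
      using spectrumI_value[OF 5(1), of ?A] spectrumI_value[OF 5(2), of ?A] A by auto
    then have "catalogued ?A" using 5 A
      by (intro catalogued.triple[where \<alpha> = a and \<beta> = b and \<gamma> = c]) (simp_all add: triple_point_algebra_def)
    then show ?thesis using h by simp
  qed
qed

text \<open>
  Each quadratic contributes a node or a cusp, depending on whether its roots are distinct.
\<close>

lemma catalogued_coprime_quadratics:
  fixes g h :: "'a::{alg_closed_field, field_char_0} poly"
  assumes deg: "degree g = 2" "degree h = 2"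
    and no_common: "\<And>z. \<not> (poly g z = 0 \<and> poly h z = 0)"
  shows "catalogued (const_mod g \<inter> const_mod h)"
proof -
  define X where "X = (\<lambda>a::'a. [:-a, 1:])"
  have pX: "poly (X a) z = z - a" for a z by (simp add: X_def)
  have node: "const_mod (X a * X b) = {f. poly f a = poly f b}" if "a \<noteq> b" for a b
    unfolding X_def by (rule const_mod_two_points[OF that])
  have cusp: "const_mod (X a * X a) = {f. poly (pderiv f) a = 0}" for a
    unfolding X_def by (rule const_mod_double_point)
  obtain k a b where k: "k \<noteq> 0" "g = smult k (X a * X b)"
    using quadratic_split[OF deg(1)] unfolding X_def by metis
  obtain j c d where j: "j \<noteq> 0" "h = smult j (X c * X d)"
    using quadratic_split[OF deg(2)] unfolding X_def by metis
  let ?A = "const_mod g \<inter> const_mod h"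
  have A: "?A = const_mod (X a * X b) \<inter> const_mod (X c * X d)"
    using k j by (simp add: const_mod_smult)
  have "a \<noteq> c" "a \<noteq> d" "b \<noteq> c" "b \<noteq> d"
    using no_common[of a] no_common[of b] k j by (auto simp: pX)
  note ne = this this[symmetric]
  have "spectrum ?A \<subseteq> {z. poly (g * h) z = 0}"
    by (rule spectrum_subset_roots) (simp add: mult_in_const_mod)
  also have "\<dots> \<subseteq> {a, b, c, d}" using k j by (auto simp: pX)
  finally have sub: "spectrum ?A \<subseteq> {a, b, c, d}" .
  consider "a = b" "c = d" | "a = b" "c \<noteq> d" | "a \<noteq> b" "c = d" | "a \<noteq> b" "c \<noteq> d" by blast
  then show ?thesis
  proof cases
    case 1
    then have A: "?A = two_cusp_algebra a c" unfolding A by (auto simp: cusp two_cusp_algebra_def)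
    then have "{a} \<subseteq> spectrum ?A" "{c} \<subseteq> spectrum ?A"
      by (intro spectrumI_deriv; simp add: two_cusp_algebra_def)+
    then have "spectrum ?A = {a, c}" using sub 1 by auto
    then show ?thesis using ne by (intro catalogued.two_cusp[OF _ _ A]) auto
  next
    case 2
    then have A: "?A = node_cusp_algebra c d a"
      unfolding A by (auto simp: cusp node node_cusp_algebra_def)
    have "{a} \<subseteq> spectrum ?A" unfolding A by (rule spectrumI_deriv) (simp add: node_cusp_algebra_def)
    moreover have "{c, d} \<subseteq> spectrum ?A"
      unfolding A by (rule spectrumI_value[OF 2(2)]) (simp add: node_cusp_algebra_def)
    ultimately have "spectrum ?A = {c, d, a}" using sub 2 by auto
    then show ?thesis using ne 2 by (intro catalogued.node_cusp[OF _ _ A]) auto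
  next
    case 3
    then have A: "?A = node_cusp_algebra a b c"
      unfolding A by (auto simp: cusp node node_cusp_algebra_def)
    have "{c} \<subseteq> spectrum ?A" unfolding A by (rule spectrumI_deriv) (simp add: node_cusp_algebra_def)
    moreover have "{a, b} \<subseteq> spectrum ?A"
      unfolding A by (rule spectrumI_value[OF 3(1)]) (simp add: node_cusp_algebra_def)
    ultimately have "spectrum ?A = {a, b, c}" using sub 3 by auto
    then show ?thesis using ne 3 by (intro catalogued.node_cusp[OF _ _ A]) auto
  next
    case 4
    then have A: "?A = two_node_algebra a b c d"
      unfolding A by (auto simp: node two_node_algebra_def)
    have "{a, b} \<subseteq> spectrum ?A"
      unfolding A by (rule spectrumI_value[OF 4(1)]) (simp add: two_node_algebra_def)
    moreover have "{c, d} \<subseteq> spectrum ?A"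
      unfolding A by (rule spectrumI_value[OF 4(2)]) (simp add: two_node_algebra_def)
    ultimately have "spectrum ?A = {a, b, c, d}" using sub by auto
    then show ?thesis using ne 4 by (intro catalogued.two_node[OF _ _ A]) auto
  qed
qed

lemma catalogued_square:
  fixes A :: "'a::field_char_0 poly set"
  assumes h: "h = [:-a, 1:] * [:-b, 1:]" and m: "poly m a \<noteq> 0" "poly m b \<noteq> 0"
    and A: "A = {f. \<exists>c d. h * h dvd f - [:c:] - smult d (h * m)}"
  shows "catalogued A"
proof -
  have "(h * h) * k \<in> A" for k unfolding A by (auto intro!: exI[of _ 0])
  then have "spectrum A \<subseteq> {z. poly (h * h) z = 0}" by (rule spectrum_subset_roots)
  also have "\<dots> \<subseteq> {a, b}" by (auto simp: h simp del: mult_pCons_left mult_pCons_right)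
  finally have sub: "spectrum A \<subseteq> {a, b}" .
  show ?thesis
  proof (cases "a = b")
    case True
    have A1: "A = one_point_algebra a (3 * poly (pderiv m) a) (- poly m a)"
      unfolding A one_point_algebra_def
      by (rule square_form_double_point) (use h m True in simp_all)
    have "{a} \<subseteq> spectrum A" unfolding A1 by (rule spectrumI_deriv) (simp add: one_point_algebra_def)
    then have "spectrum A = {a}" using sub True by auto
    then show ?thesis using m by (intro catalogued.one_point[OF _ _ A1]) auto
  next
    case False
    have A2: "A = tangent_algebra a b (poly m b) (poly m a)"
      unfolding A tangent_algebra_def by (rule square_form_two_points[OF False h m])
    have "{a, b} \<subseteq> spectrum A"
      unfolding A2 by (rule spectrumI_value[OF False]) (simp add: tangent_algebra_def)
    then have "spectrum A = {a, b}" using sub by auto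
    then show ?thesis using m by (intro catalogued.tangent[OF _ _ _ A2]) (use False in auto)
  qed
qed

lemma codim_2_catalogued:
  fixes A :: "'a::{alg_closed_field, field_char_0} poly set"
  assumes "subalgebra A" "has_codim A 2"
  shows "catalogued A"
  using assms
proof (cases rule: codim_2_normal_form)
  case (cubic g)
  then show ?thesis using catalogued_const_mod_cubic by simp
next
  case (nilpotent g u)
  then show ?thesis
  proof (cases rule: nilpotent_form)
    case (cubic h)
    then show ?thesis using catalogued_const_mod_cubic by simp
  next
    case (square h m a b)
    then show ?thesis by (rule catalogued_square)
  qed
next
  case (idempotent g u)
  then show ?thesis
  proof (cases rule: idempotent_form)
    case (cubic h)
    then show ?thesis using catalogued_const_mod_cubic by simp
  next
    case (coprime g0 g1)
    then show ?thesis using catalogued_coprime_quadratics[of g0 g1] by blast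
  qed
qed

lemma catalogued_card_spectrum:
  assumes "catalogued A"
  shows "finite (spectrum A)" "card (spectrum A) \<le> 4"
proof -
  obtain xs where xs: "spectrum A = set xs" "length xs \<le> 4"
    using assms by cases (rule that[of "[_]"] that[of "[_, _]"] that[of "[_, _, _]"]
      that[of "[_, _, _, _]"]; simp)+
  then show "finite (spectrum A)" "card (spectrum A) \<le> 4"
    using card_length[of xs] by simp_all
qed

text \<open>
  A monic quadratic without constant term has a single free coefficient. Each of the conditions
  \<open>f(\<alpha>) = f(\<beta>)\<close> and \<open>f'(\<alpha>) = 0\<close> determines that coefficient, the first through the midpoint of \<open>\<alpha>\<close>
  and \<open>\<beta>\<close>. Comparing the two determined values gives the criteria that follow.
\<close>

lemma monic_quadratic_values:
  fixes b :: "'a::field"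
  shows "poly [:0, b, 1:] z = b * z + z * z" "poly (pderiv [:0, b, 1:]) z = b + 2 * z"
    "poly (pderiv (pderiv [:0, b, 1:])) z = 2" "pderiv (pderiv (pderiv [:0, b, 1:])) = 0"
  by (simp_all add: pderiv_pCons algebra_simps)

lemma monic_quadratic_same_value:
  fixes \<alpha> :: "'a::field"
  assumes "\<alpha> \<noteq> \<beta>"
  shows "poly [:0, b, 1:] \<alpha> = poly [:0, b, 1:] \<beta> \<longleftrightarrow> b = - (\<alpha> + \<beta>)"
proof -
  have "poly [:0, b, 1:] \<alpha> - poly [:0, b, 1:] \<beta> = (\<alpha> - \<beta>) * (b + (\<alpha> + \<beta>))"
    by (simp add: algebra_simps)
  then show ?thesis using assms by (metis eq_iff_diff_eq_0 eq_neg_iff_add_eq_0 mult_eq_0_iff)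
qed

lemma monic_quadratic_critical_point:
  fixes \<alpha> :: "'a::field"
  shows "poly (pderiv [:0, b, 1:]) \<alpha> = 0 \<longleftrightarrow> b = - (2 * \<alpha>)"
  unfolding monic_quadratic_values by (rule eq_neg_iff_add_eq_0[symmetric])

lemma one_point_quadratic:
  fixes \<alpha> :: "'a::field_char_0"
  shows "(\<exists>q. [:0, q, 1:] \<in> one_point_algebra \<alpha> a b) \<longleftrightarrow> a = 0"
  by (simp add: one_point_algebra_def monic_quadratic_critical_point monic_quadratic_values(3,4)
      del: poly_pCons pderiv_pCons)

lemma tangent_quadratic:
  assumes "\<alpha> \<noteq> \<beta>"
  shows "(\<exists>q. [:0, q, 1:] \<in> tangent_algebra \<alpha> \<beta> a b) \<longleftrightarrow> a = b"
proof -
  have "a * (- (\<alpha> + \<beta>) + 2 * \<alpha>) + b * (- (\<alpha> + \<beta>) + 2 * \<beta>) = (a - b) * (\<alpha> - \<beta>)"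
    by (simp add: algebra_simps)
  then show ?thesis using assms
    by (simp add: tangent_algebra_def monic_quadratic_same_value monic_quadratic_values(2)
      del: poly_pCons pderiv_pCons)
qed

lemma two_cusp_quadratic:
  fixes \<alpha> :: "'a::field_char_0"
  assumes "\<alpha> \<noteq> \<beta>"
  shows "\<not> (\<exists>q. [:0, q, 1:] \<in> two_cusp_algebra \<alpha> \<beta>)"
  using assms by (auto simp add: two_cusp_algebra_def monic_quadratic_critical_point
      simp del: poly_pCons pderiv_pCons)

lemma node_cusp_quadratic:
  assumes "\<alpha> \<noteq> \<beta>"
  shows "(\<exists>q. [:0, q, 1:] \<in> node_cusp_algebra \<alpha> \<beta> \<gamma>) \<longleftrightarrow> \<alpha> + \<beta> = 2 * \<gamma>"
  using assms by (simp add: node_cusp_algebra_def monic_quadratic_critical_point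
      monic_quadratic_same_value del: minus_add_distrib poly_pCons pderiv_pCons)

lemma triple_quadratic:
  assumes "distinct [\<alpha>, \<beta>, \<gamma>]"
  shows "\<not> (\<exists>q. [:0, q, 1:] \<in> triple_point_algebra \<alpha> \<beta> \<gamma>)"
  using assms by (auto simp add: triple_point_algebra_def monic_quadratic_same_value
      simp del: poly_pCons pderiv_pCons)

lemma two_node_quadratic:
  assumes "\<alpha> \<noteq> \<beta>" "\<gamma> \<noteq> \<delta>"
  shows "(\<exists>q. [:0, q, 1:] \<in> two_node_algebra \<alpha> \<beta> \<gamma> \<delta>) \<longleftrightarrow> \<alpha> + \<beta> = \<gamma> + \<delta>"
  using assms by (simp add: two_node_algebra_def monic_quadratic_same_value
      del: minus_add_distrib poly_pCons pderiv_pCons)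

theorem theorem39:
  fixes A :: "'a::{alg_closed_field, field_char_0} poly set"
  assumes "subalgebra A" and "has_codim A 2"
  shows
   "(type_of A = [2, 5] \<or> type_of A = [3, 4, 5]) \<and>
    finite (spectrum A) \<and> card (spectrum A) \<le> 4 \<and>
    ((\<exists>\<alpha> a b. spectrum A = {\<alpha>} \<and> (a \<noteq> 0 \<or> b \<noteq> 0) \<and>
        A = {f. poly (pderiv f) \<alpha> = 0 \<and>
                a * poly (pderiv (pderiv f)) \<alpha> + b * poly (pderiv (pderiv (pderiv f))) \<alpha> = 0}) \<or>
     (\<exists>\<alpha> \<beta> a b. distinct [\<alpha>, \<beta>] \<and> spectrum A = {\<alpha>, \<beta>} \<and> (a \<noteq> 0 \<or> b \<noteq> 0) \<and>
        A = {f. poly f \<alpha> = poly f \<beta> \<and> a * poly (pderiv f) \<alpha> + b * poly (pderiv f) \<beta> = 0}) \<or>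
     (\<exists>\<alpha> \<beta>. distinct [\<alpha>, \<beta>] \<and> spectrum A = {\<alpha>, \<beta>} \<and>
        A = {f. poly (pderiv f) \<alpha> = 0 \<and> poly (pderiv f) \<beta> = 0}) \<or>
     (\<exists>\<alpha> \<beta> \<gamma>. distinct [\<alpha>, \<beta>, \<gamma>] \<and> spectrum A = {\<alpha>, \<beta>, \<gamma>} \<and>
        A = {f. poly f \<alpha> = poly f \<beta> \<and> poly (pderiv f) \<gamma> = 0}) \<or>
     (\<exists>\<alpha> \<beta> \<gamma>. distinct [\<alpha>, \<beta>, \<gamma>] \<and> spectrum A = {\<alpha>, \<beta>, \<gamma>} \<and>
        A = {f. poly f \<alpha> = poly f \<beta> \<and> poly f \<beta> = poly f \<gamma>}) \<or>
     (\<exists>\<alpha> \<beta> \<gamma> \<delta>. distinct [\<alpha>, \<beta>, \<gamma>, \<delta>] \<and> spectrum A = {\<alpha>, \<beta>, \<gamma>, \<delta>} \<and>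
        A = {f. poly f \<alpha> = poly f \<beta> \<and> poly f \<gamma> = poly f \<delta>})) \<and>
    (\<forall>\<alpha> a b. spectrum A = {\<alpha>} \<and>
        A = {f. poly (pderiv f) \<alpha> = 0 \<and>
                a * poly (pderiv (pderiv f)) \<alpha> + b * poly (pderiv (pderiv (pderiv f))) \<alpha> = 0} \<longrightarrow>
        (a = 0 \<and> b \<noteq> 0 \<longrightarrow> type_of A = [2, 5]) \<and> (a \<noteq> 0 \<longrightarrow> type_of A = [3, 4, 5])) \<and>
    (\<forall>\<alpha> \<beta> a b. distinct [\<alpha>, \<beta>] \<and> spectrum A = {\<alpha>, \<beta>} \<and>
        A = {f. poly f \<alpha> = poly f \<beta> \<and> a * poly (pderiv f) \<alpha> + b * poly (pderiv f) \<beta> = 0} \<longrightarrow>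
        (a = b \<and> b \<noteq> 0 \<longrightarrow> type_of A = [2, 5]) \<and> (a \<noteq> b \<longrightarrow> type_of A = [3, 4, 5])) \<and>
    (\<forall>\<alpha> \<beta>. distinct [\<alpha>, \<beta>] \<and> spectrum A = {\<alpha>, \<beta>} \<and>
        A = {f. poly (pderiv f) \<alpha> = 0 \<and> poly (pderiv f) \<beta> = 0} \<longrightarrow>
        type_of A = [3, 4, 5]) \<and>
    (\<forall>\<alpha> \<beta> \<gamma>. distinct [\<alpha>, \<beta>, \<gamma>] \<and> spectrum A = {\<alpha>, \<beta>, \<gamma>} \<and>
        A = {f. poly f \<alpha> = poly f \<beta> \<and> poly (pderiv f) \<gamma> = 0} \<longrightarrow>
        (\<alpha> + \<beta> = 2 * \<gamma> \<longrightarrow> type_of A = [2, 5]) \<and>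
        (\<alpha> + \<beta> \<noteq> 2 * \<gamma> \<longrightarrow> type_of A = [3, 4, 5])) \<and>
    (\<forall>\<alpha> \<beta> \<gamma>. distinct [\<alpha>, \<beta>, \<gamma>] \<and> spectrum A = {\<alpha>, \<beta>, \<gamma>} \<and>
        A = {f. poly f \<alpha> = poly f \<beta> \<and> poly f \<beta> = poly f \<gamma>} \<longrightarrow>
        type_of A = [3, 4, 5]) \<and>
    (\<forall>\<alpha> \<beta> \<gamma> \<delta>. distinct [\<alpha>, \<beta>, \<gamma>, \<delta>] \<and> spectrum A = {\<alpha>, \<beta>, \<gamma>, \<delta>} \<and>
        A = {f. poly f \<alpha> = poly f \<beta> \<and> poly f \<gamma> = poly f \<delta>} \<longrightarrow>
        (\<alpha> + \<beta> = \<gamma> + \<delta> \<longrightarrow> type_of A = [2, 5]) \<and>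
        (\<alpha> + \<beta> \<noteq> \<gamma> + \<delta> \<longrightarrow> type_of A = [3, 4, 5]))"
proof -
  \<comment> \<open>Stated for any \<open>B\<close> equal to \<open>A\<close>, to rewrite with it after \<open>A\<close> has
    been replaced by its equations.\<close>
  have type: "type_of B = (if \<exists>q. [:0, q, 1:] \<in> B then [2, 5] else [3, 4, 5])" if "A = B" for B
    unfolding that[symmetric] using codim_2_type[OF assms] two_in_degree_semigroup_iff[OF assms(1)] by simp
  note list = codim_2_catalogued[OF assms]
  show ?thesis
    unfolding algebra_defs[symmetric]
  proof (intro conjI)
    show "type_of A = [2, 5] \<or> type_of A = [3, 4, 5]" unfolding type[OF refl] by simp
    show "finite (spectrum A)" "card (spectrum A) \<le> 4" by (rule catalogued_card_spectrum[OF list])+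
    show "(\<exists>\<alpha> a b. spectrum A = {\<alpha>} \<and> (a \<noteq> 0 \<or> b \<noteq> 0) \<and> A = one_point_algebra \<alpha> a b) \<or>
      (\<exists>\<alpha> \<beta> a b. distinct [\<alpha>, \<beta>] \<and> spectrum A = {\<alpha>, \<beta>} \<and> (a \<noteq> 0 \<or> b \<noteq> 0) \<and>
        A = tangent_algebra \<alpha> \<beta> a b) \<or>
      (\<exists>\<alpha> \<beta>. distinct [\<alpha>, \<beta>] \<and> spectrum A = {\<alpha>, \<beta>} \<and> A = two_cusp_algebra \<alpha> \<beta>) \<or>
      (\<exists>\<alpha> \<beta> \<gamma>. distinct [\<alpha>, \<beta>, \<gamma>] \<and> spectrum A = {\<alpha>, \<beta>, \<gamma>} \<and>
        A = node_cusp_algebra \<alpha> \<beta> \<gamma>) \<or>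
      (\<exists>\<alpha> \<beta> \<gamma>. distinct [\<alpha>, \<beta>, \<gamma>] \<and> spectrum A = {\<alpha>, \<beta>, \<gamma>} \<and>
        A = triple_point_algebra \<alpha> \<beta> \<gamma>) \<or>
      (\<exists>\<alpha> \<beta> \<gamma> \<delta>. distinct [\<alpha>, \<beta>, \<gamma>, \<delta>] \<and> spectrum A = {\<alpha>, \<beta>, \<gamma>, \<delta>} \<and>
        A = two_node_algebra \<alpha> \<beta> \<gamma> \<delta>)"
      (is "?C1 \<or> ?C2 \<or> ?C3 \<or> ?C4 \<or> ?C5 \<or> ?C6")
      using list
    proof cases
      case (one_point \<alpha> a b)
      then have ?C1 by (intro exI conjI)
      then show ?thesis by (rule disjI1)
    next
      case (tangent \<alpha> \<beta> a b)
      then have ?C2 by (intro exI conjI)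
      then show ?thesis by simp
    next
      case (two_cusp \<alpha> \<beta>)
      then have ?C3 by (intro exI conjI)
      then show ?thesis by simp
    next
      case (node_cusp \<alpha> \<beta> \<gamma>)
      then have ?C4 by (intro exI conjI)
      then show ?thesis by simp
    next
      case (triple \<alpha> \<beta> \<gamma>)
      then have ?C5 by (intro exI conjI)
      then show ?thesis by simp
    next
      case (two_node \<alpha> \<beta> \<gamma> \<delta>)
      then have ?C6 by (intro exI conjI)
      then show ?thesis by simp
    qed
  qed (auto simp: type one_point_quadratic tangent_quadratic two_cusp_quadratic
      node_cusp_quadratic triple_quadratic two_node_quadratic)
qed

end
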